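(* Let $X$ be a real Banach space, $X\neq\{0\}$. (1) $X$ has the Radon-Nikodym property (RNP) if, and only if, for every equivalent norm on $X$, the unit sphere of $X$ for that norm contains Lip-slices (with respect to that norm) of arbitrarily small diameter. (2) $X$ has the convex point of continuity property (CPCP) if, and only if, for every equivalent norm on $X$, the unit sphere of $X$ for that norm contains non-empty relatively open subsets, for the Lip-topology (with respect to that norm), of arbitrarily small diameter. (3) $X$ is strongly regular (SR) if, and only if, for every equivalent norm on $X$, the unit ball of $X$ for that norm contains convex combinations of Lip-slices (of the unit sphere for that norm) of arbitrarily small diameter.
   Context: $B_X$ and $S_X$ denote the closed unit ball and unit sphere of $X$. A slice of a bounded non-empty set $C\subseteq X$ is a set $S(C,f,\alpha)=\{x\in C: f(x)>\sup_{C}f-\alpha\}$ with $f\in X^*$, $f\ne0$, $\alpha>0$. For a Lipschitz function $f:X\to\mathbb R$, let $\|f\|$ denote its (best) Lipschitz constant. A Lip-slice of $S_X$ is a non-empty set of the form $$S(S_X,f,\varepsilon):=\left\{\frac{x_1-x_2}{\|x_1-x_2\|}:\ x_1,x_2\in X,\ x_1\neq x_2,\ \frac{f(x_1)-f(x_2)}{\|x_1-x_2\|}>\|f\|-\varepsilon\right\},$$ where $f:X\to\mathbb R$ is Lipschitz and $\varepsilon>0$. The Lip-topology on $S_X$ is the topology generated by the family of all Lip-slices of $S_X$ as a subbasis. All these notions depend on the norm of $X$. A convex combination of (Lip-)slices is a set of the form $\sum_{i=1}^n\lambda_iS_i=\{\sum_{i=1}^n\lambda_i s_i: s_i\in S_i\}$,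 where $n\ge 1$, $\lambda_i\ge 0$, $\sum_{i=1}^n\lambda_i=1$ and each $S_i$ is a (Lip-)slice. $X$ has the RNP (respectively the CPCP; is strongly regular) if every non-empty closed, bounded and convex subset of $X$ contains slices (respectively non-empty relatively weakly open subsets; convex combinations of slices of itself) of arbitrarily small diameter. *)

theory Defs
  imports "HOL-Analysis.Analysis"
begin

definition slice :: "'a::real_normed_vector set \<Rightarrow> ('a \<Rightarrow>\<^sub>L real) \<Rightarrow> real \<Rightarrow> 'a set" where
  "slice C f \<alpha> = {x \<in> C. blinfun_apply f x > (SUP y\<in>C. blinfun_apply f y) - \<alpha>}"

definition slices :: "'a::real_normed_vector set \<Rightarrow> 'a set set" where
  "slices C = {slice C f \<alpha> |f \<alpha>. f \<noteq> 0 \<and> \<alpha> > 0}"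

definition weak_topology :: "'a::real_normed_vector topology" where
  "weak_topology =
     topology_generated_by {blinfun_apply f -` U |(f :: 'a \<Rightarrow>\<^sub>L real) U. open U}"

definition convex_combinations :: "'a::real_vector set set \<Rightarrow> 'a set set" where
  "convex_combinations F =
     {{\<Sum>i=1..n. c i *\<^sub>R s i |s. \<forall>i\<in>{1..n}. s i \<in> S i} |(n::nat) c S.
        n \<ge> 1 \<and> (\<forall>i\<in>{1..n}. c i \<ge> 0 \<and> S i \<in> F) \<and> (\<Sum>i=1..n. c i) = 1}"

definition RNP :: "'a::banach itself \<Rightarrow> bool" where
  "RNP TYPE('a) \<longleftrightarrow>
     (\<forall>C::'a set. C \<noteq> {} \<and> closed C \<and> bounded C \<and> convex C \<longrightarrow>
        (\<forall>\<delta>>0. \<exists>S\<in>slices C. diameter S < \<delta>))"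

definition CPCP :: "'a::banach itself \<Rightarrow> bool" where
  "CPCP TYPE('a) \<longleftrightarrow>
     (\<forall>C::'a set. C \<noteq> {} \<and> closed C \<and> bounded C \<and> convex C \<longrightarrow>
        (\<forall>\<delta>>0. \<exists>U. openin (subtopology weak_topology C) U \<and> U \<noteq> {} \<and> diameter U < \<delta>))"

definition strongly_regular :: "'a::banach itself \<Rightarrow> bool" where
  "strongly_regular TYPE('a) \<longleftrightarrow>
     (\<forall>C::'a set. C \<noteq> {} \<and> closed C \<and> bounded C \<and> convex C \<longrightarrow>
        (\<forall>\<delta>>0. \<exists>S\<in>convex_combinations (slices C). diameter S < \<delta>))"

text \<open>
  Renormings are functions \<open>N\<close> on the fixed type; below, every metric notion (unit ball, unit
  sphere, Lipschitz constant, diameter) is taken with respect to \<open>N\<close>.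
\<close>

definition equivalent_norm :: "('a::real_normed_vector \<Rightarrow> real) \<Rightarrow> bool" where
  "equivalent_norm N \<longleftrightarrow>
     (\<forall>x. N x = 0 \<longleftrightarrow> x = 0) \<and>
     (\<forall>a x. N (a *\<^sub>R x) = \<bar>a\<bar> * N x) \<and>
     (\<forall>x y. N (x + y) \<le> N x + N y) \<and>
     (\<exists>a>0. \<exists>b>0. \<forall>x. a * norm x \<le> N x \<and> N x \<le> b * norm x)"

definition unit_ball :: "('a::real_vector \<Rightarrow> real) \<Rightarrow> 'a set" where
  "unit_ball N = {x. N x \<le> 1}"

definition unit_sphere :: "('a::real_vector \<Rightarrow> real) \<Rightarrow> 'a set" where
  "unit_sphere N = {x. N x = 1}"

text \<open>As for the library constant \<open>diameter\<close>, the value is only meaningful for bounded sets.\<close>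

definition norm_diameter :: "('a::real_vector \<Rightarrow> real) \<Rightarrow> 'a set \<Rightarrow> real" where
  "norm_diameter N S = (if S = {} then 0 else SUP (x, y)\<in>S \<times> S. N (x - y))"

definition norm_lipschitz :: "('a::real_vector \<Rightarrow> real) \<Rightarrow> ('a \<Rightarrow> real) \<Rightarrow> bool" where
  "norm_lipschitz N f \<longleftrightarrow> (\<exists>L\<ge>0. \<forall>x y. \<bar>f x - f y\<bar> \<le> L * N (x - y))"

definition lipschitz_const :: "('a::real_vector \<Rightarrow> real) \<Rightarrow> ('a \<Rightarrow> real) \<Rightarrow> real" where
  "lipschitz_const N f = Inf {L. L \<ge> 0 \<and> (\<forall>x y. \<bar>f x - f y\<bar> \<le> L * N (x - y))}"

definition lip_slice :: "('a::real_vector \<Rightarrow> real) \<Rightarrow> ('a \<Rightarrow> real) \<Rightarrow> real \<Rightarrow> 'a set" where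
  "lip_slice N f \<epsilon> =
     {(x1 - x2) /\<^sub>R N (x1 - x2) |x1 x2.
        x1 \<noteq> x2 \<and> (f x1 - f x2) / N (x1 - x2) > lipschitz_const N f - \<epsilon>}"

definition lip_slices :: "('a::real_vector \<Rightarrow> real) \<Rightarrow> 'a set set" where
  "lip_slices N = {lip_slice N f \<epsilon> |f \<epsilon>. norm_lipschitz N f \<and> \<epsilon> > 0 \<and> lip_slice N f \<epsilon> \<noteq> {}}"

text \<open>
  The Lip-slices of constant functions are the whole unit sphere, so the carrier of the
  following topology is \<open>unit_sphere N\<close> whenever \<open>N\<close> is a norm.
\<close>

definition lip_topology :: "('a::real_vector \<Rightarrow> real) \<Rightarrow> 'a topology" where
  "lip_topology N = topology_generated_by (lip_slices N)"

end

theory Submission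
  imports Defs
begin

text \<open>
  The largest slope of a Lipschitz function \<open>f\<close> in the direction \<open>a\<close>, taken over all segments of
  that direction, is a sublinear function of \<open>a\<close>. By Hahn-Banach it dominates a linear functional
  that agrees with it at a prescribed point, so every Lip-slice is a union of open half-spaces
  intersected with the sphere, and Lip-slices may be replaced by linear slices. Applied to the unit
  ball of an equivalent norm, RNP, CPCP and strong regularity then give the small sets on the
  sphere. Conversely, for a bounded convex set \<open>C\<close>, the norm whose unit ball is the closure of
  \<open>conv (C \<union> - C) + cball 0 1\<close> has the property that slices of the ball, and weak neighbourhoods in
  it, contain translates of \<open>\<plusminus>\<close> slices of \<open>C\<close>, respectively of weak neighbourhoods in \<open>C\<close> scaled
  by a factor of absolute value at least \<open>1/2\<close>.
\<close>

subsection \<open>Hahn-Banach\<close>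

text \<open>Two gaps shape the estimates. Lip-slices lie in the sphere, whereas RNP, CPCP and strong
  regularity concern convex sets such as balls; points of the ball at which a functional almost
  attains its norm have norm almost one, so radial projection moves them little. Moreover, a slice
  of a body built from \<open>C\<close> and \<open>- C\<close> may see only one of the two sides.
  For a single slice this is harmless, since a reflection preserves distances. In a convex
  combination the slices can choose different signs, and in a weak neighbourhood a point can mix
  both sides; then only the side carrying at least half of the weight is varied, which costs a
  factor 2. The summand \<open>cball 0 1\<close> gives the body an interior, so that its gauge is an
  equivalent norm; in comparing diameters it contributes only a translation.\<close>

definition sublinear :: "('a::real_vector \<Rightarrow> real) \<Rightarrow> bool" where
  "sublinear p \<longleftrightarrow> (\<forall>x y. p (x + y) \<le> p x + p y) \<and> (\<forall>t x. t \<ge> 0 \<longrightarrow> p (t *\<^sub>R x) = t * p x)"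

lemma sublinear_add: "sublinear p \<Longrightarrow> p (x + y) \<le> p x + p y"
  by (simp add: sublinear_def)

lemma sublinear_scale: "sublinear p \<Longrightarrow> t \<ge> 0 \<Longrightarrow> p (t *\<^sub>R x) = t * p x"
  by (simp add: sublinear_def)

lemma sublinear_0: "sublinear p \<Longrightarrow> p 0 = 0"
  using sublinear_scale[of p 0 0] by simp

lemma sublinear_neg: "sublinear p \<Longrightarrow> - p (- x) \<le> p x"
  using sublinear_add[of p x "- x"] sublinear_0[of p] by simp

text \<open>The inequality for positive scalars implies equality: applied to
  \<open>t *\<^sub>R x\<close> with the scalar \<open>inverse t\<close>, it yields the reverse
  estimate.\<close>

lemma sublinearI:
  assumes add: "\<And>x y. p (x + y) \<le> p x + p y" and zero: "p 0 = 0"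
    and scale: "\<And>t x. t > 0 \<Longrightarrow> p (t *\<^sub>R x) \<le> t * p x"
  shows "sublinear p"
proof -
  have "p (t *\<^sub>R x) = t * p x" if "t \<ge> 0" for t x
  proof (cases "t = 0")
    case False
    then have t: "t > 0" using that by simp
    have "p (inverse t *\<^sub>R (t *\<^sub>R x)) \<le> inverse t * p (t *\<^sub>R x)"
      using t by (intro scale) simp
    then have "t * p x \<le> p (t *\<^sub>R x)"
      using t by (simp add: field_simps)
    with scale[OF t, of x] show ?thesis by simp
  qed (simp add: zero)
  with add show ?thesis by (simp add: sublinear_def)
qed

text \<open>Moving along \<open>x\<close> while subtracting \<open>t * p x\<close> lowers
  \<open>p\<close> in the direction \<open>- x\<close> and keeps it sublinear; the infimum is finite
  because every term is at least \<open>- p (- y)\<close>. A linear functional below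
  \<open>q\<close> must take the value \<open>p x\<close> at \<open>x\<close>.\<close>

lemma sublinear_decrease:
  assumes p: "sublinear p"
  obtains q where "sublinear q" "\<And>y. q y \<le> p y" "q (- x) \<le> - p x"
proof -
  define q where "q y = (INF t\<in>{0..}. p (y + t *\<^sub>R x) - t * p x)" for y
  have bdd: "bdd_below ((\<lambda>t. p (y + t *\<^sub>R x) - t * p x) ` {0..})" for y
  proof (rule bdd_belowI2[where m = "- p (- y)"])
    fix t :: real assume "t \<in> {0..}"
    then have "t * p x = p (t *\<^sub>R x)" using p by (simp add: sublinear_scale)
    also have "\<dots> \<le> p (y + t *\<^sub>R x) + p (- y)"
      using sublinear_add[OF p, of "y + t *\<^sub>R x" "- y"] by simp
    finally show "- p (- y) \<le> p (y + t *\<^sub>R x) - t * p x" by simp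
  qed
  have le: "q y \<le> p (y + t *\<^sub>R x) - t * p x" if "t \<ge> 0" for y t
    unfolding q_def using that by (intro cINF_lower bdd) auto
  have ge: "m \<le> q y" if "\<And>t. t \<ge> 0 \<Longrightarrow> m \<le> p (y + t *\<^sub>R x) - t * p x" for m y
    unfolding q_def using that by (intro cINF_greatest) auto
  have "sublinear q"
  proof (rule sublinearI)
    show "q (y + z) \<le> q y + q z" for y z
    proof -
      have *: "q (y + z) \<le> (p (y + s *\<^sub>R x) - s * p x) + (p (z + t *\<^sub>R x) - t * p x)"
        if "s \<ge> 0" "t \<ge> 0" for s t
        using le[of "s + t" "y + z"] that sublinear_add[OF p, of "y + s *\<^sub>R x" "z + t *\<^sub>R x"]
        by (simp add: algebra_simps)
      have "q (y + z) - q y \<le> q z"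
      proof (rule ge)
        fix t :: real assume "t \<ge> 0"
        then have "q (y + z) - (p (z + t *\<^sub>R x) - t * p x) \<le> q y"
          using * by (intro ge) (simp add: algebra_simps)
        then show "q (y + z) - q y \<le> p (z + t *\<^sub>R x) - t * p x" by simp
      qed
      then show ?thesis by simp
    qed
    show "q 0 = 0"
      using le[of 0 0] ge[of 0 0] p by (simp add: sublinear_0 sublinear_scale)
    show "q (r *\<^sub>R y) \<le> r * q y" if r: "r > 0" for r y
    proof -
      have "q (r *\<^sub>R y) / r \<le> q y"
      proof (rule ge)
        fix t :: real assume "t \<ge> 0"
        then have "q (r *\<^sub>R y) \<le> p (r *\<^sub>R (y + t *\<^sub>R x)) - (r * t) * p x"
          using le[of "r * t" "r *\<^sub>R y"] r by (simp add: algebra_simps)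
        also have "\<dots> = r * (p (y + t *\<^sub>R x) - t * p x)"
          using sublinear_scale[OF p, of r "y + t *\<^sub>R x"] r by (simp add: right_diff_distrib mult.assoc)
        finally show "q (r *\<^sub>R y) / r \<le> p (y + t *\<^sub>R x) - t * p x"
          using r by (simp add: field_simps)
      qed
      then show ?thesis using r by (simp add: field_simps)
    qed
  qed
  moreover have "q y \<le> p y" for y using le[of 0 y] by simp
  moreover have "q (- x) \<le> - p x" using le[of 1 "- x"] sublinear_0[OF p] by simp
  ultimately show thesis by (rule that)
qed

text \<open>Zorn's lemma for the reversed pointwise order. The pointwise infimum of a chain is
  finite, since \<open>- p (- y)\<close> bounds all sublinear functionals below \<open>p\<close>
  from below.\<close>

lemma minimal_sublinear:
  fixes p :: "'a::real_vector \<Rightarrow> real"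
  assumes p: "sublinear p"
  obtains m where "sublinear m" "\<And>y. m y \<le> p y"
    "\<And>q. sublinear q \<Longrightarrow> (\<And>y. q y \<le> m y) \<Longrightarrow> q = m"
proof -
  define A where "A = {q. sublinear q \<and> q \<le> p}"
  define P where "P = (\<lambda>a b::'a \<Rightarrow> real. b \<le> a)"
  have "\<exists>m\<in>A. \<forall>a\<in>A. P m a \<longrightarrow> a = m"
  proof (rule predicate_Zorn)
    show "partial_order_on A (relation_of P A)"
      by (rule partial_order_on_relation_ofI) (auto simp: P_def)
    fix C assume "C \<in> Chains (relation_of P A)"
    then have CA: "C \<subseteq> A" and tot: "\<And>a b. a \<in> C \<Longrightarrow> b \<in> C \<Longrightarrow> a \<le> b \<or> b \<le> a"
      by (auto simp: Chains_def relation_of_def P_def)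
    show "\<exists>u\<in>A. \<forall>a\<in>C. P a u"
    proof (cases "C = {}")
      case True
      then show ?thesis using p by (auto simp: A_def)
    next
      case False
      define u where "u y = (INF q\<in>C. q y)" for y
      have lin: "sublinear q" and qp: "q y \<le> p y" if "q \<in> C" for q y
        using CA that by (auto simp: A_def le_fun_def)
      have bdd: "bdd_below ((\<lambda>q. q y) ` C)" for y
      proof (rule bdd_belowI2[where m = "- p (- y)"])
        fix q assume "q \<in> C"
        with sublinear_neg[OF lin, of q y] qp[of q "- y"] show "- p (- y) \<le> q y" by simp
      qed
      have le: "u y \<le> q y" if "q \<in> C" for q y
        unfolding u_def using that by (intro cINF_lower bdd)
      have ge: "m \<le> u y" if "\<And>q. q \<in> C \<Longrightarrow> m \<le> q y" for m y
        unfolding u_def using that False by (intro cINF_greatest)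
      have "sublinear u"
      proof (rule sublinearI)
        show "u (y + z) \<le> u y + u z" for y z
        proof -
          \<comment> \<open>Subadditivity passes to the infimum because of the chain condition: the
            smaller of \<open>q\<close> and \<open>r\<close> can be used at both points.\<close>
          have *: "u (y + z) \<le> q y + r z" if qr: "q \<in> C" "r \<in> C" for q r
            using tot[OF qr]
          proof
            assume "q \<le> r"
            then show ?thesis
              using le[of q "y + z"] sublinear_add[OF lin, of q y z] qr
              by (simp add: le_fun_def) (meson add_left_mono order_trans)
          next
            assume "r \<le> q"
            then show ?thesis
              using le[of r "y + z"] sublinear_add[OF lin, of r y z] qr
              by (simp add: le_fun_def) (meson add_right_mono order_trans)
          qed
          have "u (y + z) - u y \<le> u z"
          proof (rule ge)
            fix r assume "r \<in> C"
            then have "u (y + z) - r z \<le> u y"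
              using * by (intro ge) (simp add: algebra_simps)
            then show "u (y + z) - u y \<le> r z" by simp
          qed
          then show ?thesis by simp
        qed
        show "u 0 = 0"
          unfolding u_def using False lin by (simp add: sublinear_0 cong: INF_cong_simp)
        show "u (t *\<^sub>R y) \<le> t * u y" if "t > 0" for t y
        proof -
          have "u (t *\<^sub>R y) / t \<le> u y"
            using that le[of _ "t *\<^sub>R y"] lin
            by (intro ge) (force simp: sublinear_scale field_simps)
          then show ?thesis using that by (simp add: field_simps)
        qed
      qed
      moreover have "u \<le> p"
      proof (rule le_funI)
        fix y
        obtain q where "q \<in> C" using False by blast
        then show "u y \<le> p y" using le[of q y] qp[of q y] by simp
      qed
      ultimately show ?thesis
        using le by (intro bexI[of _ u]) (auto simp: A_def P_def le_fun_def)
    qed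
  qed
  then obtain m where m: "m \<in> A" "\<And>a. a \<in> A \<Longrightarrow> a \<le> m \<Longrightarrow> a = m"
    by (auto simp: P_def)
  show thesis
  proof (rule that)
    show "sublinear m" "\<And>y. m y \<le> p y" using m(1) by (auto simp: A_def le_fun_def)
    show "q = m" if "sublinear q" "\<And>y. q y \<le> m y" for q
    proof (rule m(2))
      show "q \<le> m" using that(2) by (rule le_funI)
      with m(1) that(1) show "q \<in> A" by (auto simp: A_def)
    qed
  qed
qed

text \<open>The minimal sublinear functionals are exactly the linear ones.\<close>

lemma hahn_banach:
  fixes p :: "'a::real_vector \<Rightarrow> real"
  assumes "sublinear p"
  obtains D where "linear D" "\<And>y. D y \<le> p y" "D x = p x"
proof -
  \<comment> \<open>Starting below \<open>q\<close> instead of \<open>p\<close> fixes the value at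
    \<open>x\<close> in advance: oddness of the minimal functional turns
    \<open>q (- x) \<le> - p x\<close> into \<open>p x \<le> m x\<close>.\<close>
  obtain q where q: "sublinear q" "\<And>y. q y \<le> p y" "q (- x) \<le> - p x"
    using sublinear_decrease[OF assms] by blast
  obtain m where m: "sublinear m" "\<And>y. m y \<le> q y"
    and min: "\<And>r. sublinear r \<Longrightarrow> (\<And>y. r y \<le> m y) \<Longrightarrow> r = m"
    using minimal_sublinear[OF q(1)] by blast
  \<comment> \<open>Minimality absorbs a further decrease in direction \<open>y\<close>, so
    \<open>m (- y) \<le> - m y\<close>; an odd sublinear functional is additive and
    homogeneous.\<close>
  have neg: "m (- y) = - m y" for y
  proof -
    obtain r where r: "sublinear r" "\<And>z. r z \<le> m z" "r (- y) \<le> - m y"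
      using sublinear_decrease[OF m(1)] by blast
    with min have "r = m" by blast
    with r(3) sublinear_neg[OF m(1), of y] show ?thesis by simp
  qed
  have "linear m"
  proof (rule linearI)
    show "m (y + z) = m y + m z" for y z
      using sublinear_add[OF m(1), of y z] sublinear_add[OF m(1), of "- y" "- z"] neg[of "y + z"]
      by (simp add: neg)
    show "m (t *\<^sub>R y) = t *\<^sub>R m y" for t y
      using sublinear_scale[OF m(1), of t y] sublinear_scale[OF m(1), of "- t" y]
        neg[of "t *\<^sub>R y"]
      by (cases "t \<ge> 0") auto
  qed
  moreover have "m y \<le> p y" for y using m(2) q(2) order_trans by blast
  moreover have "m x = p x"
    using m(2)[of "- x"] q(3) neg[of x] \<open>m x \<le> p x\<close> by simp
  ultimately show thesis by (rule that)
qed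


subsection \<open>Slices and basic open sets\<close>

lemma bdd_above_blinfun_image:
  fixes g :: "'a::real_normed_vector \<Rightarrow>\<^sub>L real"
  shows "bounded C \<Longrightarrow> bdd_above (blinfun_apply g ` C)"
  by (intro bounded_imp_bdd_above bounded_linear_image blinfun.bounded_linear_right)

lemma slice_nonempty:
  assumes "C \<noteq> {}" "\<alpha> > 0"
  shows "slice C g \<alpha> \<noteq> {}"
proof -
  have "\<exists>y\<in>blinfun_apply g ` C. (SUP y\<in>C. g y) - \<alpha> < y"
    using assms by (intro less_cSupD) auto
  then show ?thesis by (auto simp: slice_def)
qed

lemma slice_subset: "slice C g \<alpha> \<subseteq> C"
  by (auto simp: slice_def)

lemma convex_combinationsI:
  fixes n :: nat
  assumes "n \<ge> 1" "\<forall>i\<in>{1..n}. c i \<ge> 0 \<and> P i \<in> F" "(\<Sum>i=1..n. c i) = 1"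
  shows "{\<Sum>i=1..n. c i *\<^sub>R s i |s. \<forall>i\<in>{1..n}. s i \<in> P i} \<in> convex_combinations F"
  unfolding convex_combinations_def mem_Collect_eq using assms
  by (intro exI[of _ n] exI[of _ c] exI[of _ P] conjI refl)

lemma convex_combinationsE:
  assumes "S \<in> convex_combinations F"
  obtains n :: nat and c P where
    "S = {\<Sum>i=1..n. c i *\<^sub>R s i |s. \<forall>i\<in>{1..n}. s i \<in> P i}" "n \<ge> 1"
    "\<forall>i\<in>{1..n}. c i \<ge> 0 \<and> P i \<in> F" "(\<Sum>i=1..n. c i) = 1"
  using assms unfolding convex_combinations_def mem_Collect_eq by (elim exE conjE)

text \<open>Finite intersections of subbasic sets form a base. The family has to be non-empty: the
  carrier of the topology is \<open>\<Union>\<S>\<close>, and the empty intersection would be the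
  whole type.\<close>

lemma openin_topology_generated_by_finite_Inter:
  assumes "openin (topology_generated_by \<S>) U" "x \<in> U"
  obtains \<F> where "finite \<F>" "\<F> \<noteq> {}" "\<F> \<subseteq> \<S>" "x \<in> \<Inter>\<F>" "\<Inter>\<F> \<subseteq> U"
proof -
  have "generate_topology_on \<S> U"
    using assms(1) by (simp add: openin_topology_generated_by_iff)
  then have "\<exists>\<F>. finite \<F> \<and> \<F> \<noteq> {} \<and> \<F> \<subseteq> \<S> \<and> x \<in> \<Inter>\<F> \<and> \<Inter>\<F> \<subseteq> U"
    using assms(2)
  proof (induction arbitrary: x)
    case Empty
    then show ?case by simp
  next
    case (Int a b)
    from Int.IH(1)[of x] Int.prems obtain F1
      where "finite F1" "F1 \<noteq> {}" "F1 \<subseteq> \<S>" "x \<in> \<Inter>F1" "\<Inter>F1 \<subseteq> a" by auto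
    moreover from Int.IH(2)[of x] Int.prems obtain F2
      where "finite F2" "F2 \<noteq> {}" "F2 \<subseteq> \<S>" "x \<in> \<Inter>F2" "\<Inter>F2 \<subseteq> b" by auto
    ultimately show ?case by (intro exI[of _ "F1 \<union> F2"]) auto
  next
    case (UN K)
    then obtain k where k: "k \<in> K" "x \<in> k" by blast
    with UN.IH[OF k] show ?case by (meson Sup_upper order_trans)
  next
    case (Basis s)
    then show ?case by (intro exI[of _ "{s}"]) auto
  qed
  with that show thesis by blast
qed

text \<open>A weak neighbourhood of \<open>x\<close> relative to \<open>C\<close>, written as a
  property of its points so that finitely many can be combined and \<open>x\<close> itself may lie
  outside \<open>C\<close>. The one-sided inequalities match the half-spaces of slices; a two-sided
  condition on \<open>f\<close> is obtained from \<open>f\<close> and \<open>- f\<close>.\<close>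

definition weakly_near :: "'a::real_normed_vector set \<Rightarrow> 'a \<Rightarrow> ('a \<Rightarrow> bool) \<Rightarrow> bool" where
  "weakly_near C x P \<longleftrightarrow> (\<exists>(F :: ('a \<Rightarrow>\<^sub>L real) set) \<eta>. finite F \<and> \<eta> > 0 \<and>
     (\<forall>a\<in>C. (\<forall>g\<in>F. blinfun_apply g a > blinfun_apply g x - \<eta>) \<longrightarrow> P a))"

lemma weakly_nearI:
  fixes F :: "('a::real_normed_vector \<Rightarrow>\<^sub>L real) set"
  assumes "finite F" "\<eta> > 0"
    "\<And>a. a \<in> C \<Longrightarrow> (\<And>g. g \<in> F \<Longrightarrow> blinfun_apply g a > blinfun_apply g x - \<eta>) \<Longrightarrow> P a"
  shows "weakly_near C x P"
  unfolding weakly_near_def using assms(1,2)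
  by (intro exI[of _ F] exI[of _ \<eta>] conjI ballI impI assms(3)) simp_all

lemma weakly_nearE:
  fixes x :: "'a::real_normed_vector"
  assumes "weakly_near C x P"
  obtains F :: "('a \<Rightarrow>\<^sub>L real) set" and \<eta>
  where "finite F" "\<eta> > 0"
    "\<forall>a\<in>C. (\<forall>g\<in>F. blinfun_apply g a > blinfun_apply g x - \<eta>) \<longrightarrow> P a"
  using assms unfolding weakly_near_def by (elim exE conjE)

lemma weakly_near_finite:
  fixes x :: "'a::real_normed_vector"
  assumes "finite I" and "\<And>i. i \<in> I \<Longrightarrow> weakly_near C x (P i)"
  shows "weakly_near C x (\<lambda>a. \<forall>i\<in>I. P i a)"
  using assms
proof (induction I)
  case empty
  show ?case by (rule weakly_nearI[of "{}" 1]) auto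
next
  case (insert i I)
  from insert.prems have "weakly_near C x (P i)" by simp
  then obtain F :: "('a \<Rightarrow>\<^sub>L real) set" and \<eta> where F: "finite F" "\<eta> > 0"
    "\<forall>a\<in>C. (\<forall>g\<in>F. blinfun_apply g a > blinfun_apply g x - \<eta>) \<longrightarrow> (P i a)"
    by (rule weakly_nearE)
  from insert have "weakly_near C x (\<lambda>a. \<forall>i\<in>I. P i a)" by simp
  then obtain F' :: "('a \<Rightarrow>\<^sub>L real) set" and \<eta>' where F': "finite F'" "\<eta>' > 0"
    "\<forall>a\<in>C. (\<forall>g\<in>F'. blinfun_apply g a > blinfun_apply g x - \<eta>') \<longrightarrow> (\<forall>i\<in>I. P i a)"
    by (rule weakly_nearE)
  show ?case
  proof (rule weakly_nearI[of "F \<union> F'" "min \<eta> \<eta>'"])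
    fix a assume a: "a \<in> C" "\<And>g. g \<in> F \<union> F' \<Longrightarrow> blinfun_apply g a > blinfun_apply g x - min \<eta> \<eta>'"
    have "blinfun_apply g a > blinfun_apply g x - \<eta>" if "g \<in> F" for g using a(2)[of g] that by simp
    moreover have "blinfun_apply g a > blinfun_apply g x - \<eta>'" if "g \<in> F'" for g using a(2)[of g] that by simp
    ultimately show "\<forall>i\<in>insert i I. P i a" using F(3) F'(3) a(1) by simp
  qed (use F F' in auto)
qed

lemma weakly_near_mono:
  assumes "weakly_near C x P" "\<And>a. P a \<Longrightarrow> Q a"
  shows "weakly_near C x Q"
  using assms unfolding weakly_near_def by meson

lemma weak_nbhd:
  fixes x :: "'a::real_normed_vector"
  assumes "openin (subtopology weak_topology C) U" "x \<in> U"
  shows "weakly_near C x (\<lambda>a. a \<in> U)"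
proof -
  obtain T where T: "openin weak_topology T" "U = T \<inter> C"
    using assms(1) by (auto simp: openin_subtopology)
  have "x \<in> T" using assms(2) T(2) by simp
  obtain \<F> where \<F>: "finite \<F>" "\<F> \<noteq> {}"
    "\<F> \<subseteq> {blinfun_apply f -` V |(f :: 'a \<Rightarrow>\<^sub>L real) V. open V}" "x \<in> \<Inter>\<F>" "\<Inter>\<F> \<subseteq> T"
    by (rule openin_topology_generated_by_finite_Inter[OF T(1)[unfolded weak_topology_def] \<open>x \<in> T\<close>])
  have near: "weakly_near C x (\<lambda>a. a \<in> W)" if WF: "W \<in> \<F>" for W
  proof -
    obtain f :: "'a \<Rightarrow>\<^sub>L real" and V where W: "W = blinfun_apply f -` V" "open V"
      using subsetD[OF \<F>(3) WF] unfolding mem_Collect_eq by (elim exE conjE)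
    have "f x \<in> V" using \<F>(4) WF unfolding W(1) by fast
    then obtain \<eta> where \<eta>: "\<eta> > 0" "\<And>y. dist y (f x) < \<eta> \<Longrightarrow> y \<in> V"
      using W(2) unfolding open_dist by blast
    show ?thesis
    proof (rule weakly_nearI[of "{f, -f}" \<eta>])
      fix a assume "\<And>g. g \<in> {f, -f} \<Longrightarrow> blinfun_apply g x - \<eta> < blinfun_apply g a"
      from this[of f] this[of "-f"] have "dist (f a) (f x) < \<eta>"
        by (simp add: dist_real_def blinfun.minus_left abs_less_iff)
      then show "a \<in> W" unfolding W(1) by (auto intro: \<eta>(2))
    qed (use \<eta>(1) in auto)
  qed
  have "weakly_near C x (\<lambda>a. \<forall>W\<in>\<F>. a \<in> W)"
    using \<F>(1) near by (rule weakly_near_finite)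
  then obtain F :: "('a \<Rightarrow>\<^sub>L real) set" and \<eta> where F: "finite F" "\<eta> > 0"
    "\<forall>a\<in>C. (\<forall>g\<in>F. blinfun_apply g a > blinfun_apply g x - \<eta>) \<longrightarrow> (\<forall>W\<in>\<F>. a \<in> W)"
    by (rule weakly_nearE)
  show ?thesis
  proof (rule weakly_nearI[OF F(1,2)])
    fix a assume a: "a \<in> C" "\<And>g. g \<in> F \<Longrightarrow> blinfun_apply g a > blinfun_apply g x - \<eta>"
    have "\<forall>W\<in>\<F>. a \<in> W" using a F(3) by simp
    with a(1) \<F>(5) T(2) show "a \<in> U" by blast
  qed
qed

lemma openin_weak_halfspaces:
  fixes F :: "('a::real_normed_vector \<Rightarrow>\<^sub>L real) set"
  assumes "finite F"
  shows "openin (subtopology weak_topology C) {a \<in> C. \<forall>g\<in>F. blinfun_apply g a > c g}"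
proof -
  have half: "openin weak_topology {a. blinfun_apply g a > r}" for g :: "'a \<Rightarrow>\<^sub>L real" and r
    unfolding weak_topology_def
    by (rule topology_generated_by_Basis) (auto intro!: exI[of _ g] exI[of _ "{r<..}"])
  have "openin weak_topology {a. \<forall>g\<in>F. blinfun_apply g a > c g}"
    using assms
  proof (induction F)
    case empty
    have "openin weak_topology ({a. blinfun_apply (0 :: 'a \<Rightarrow>\<^sub>L real) a > -1})" by (rule half)
    then show ?case by simp
  next
    case (insert g F)
    then have "openin weak_topology ({a. blinfun_apply g a > c g} \<inter> {a. \<forall>g\<in>F. blinfun_apply g a > c g})"
      by (intro openin_Int half)
    then show ?case by (rule back_subst[of "openin weak_topology"]) auto
  qed
  then show ?thesis
    unfolding openin_subtopology by (intro exI[of _ "{a. \<forall>g\<in>F. blinfun_apply g a > c g}"]) auto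
qed

subsection \<open>Equivalent norms\<close>

locale equiv_norm =
  fixes N :: "'a::banach \<Rightarrow> real"
  assumes equivalent: "equivalent_norm N"
begin

lemma zero_iff: "N x = 0 \<longleftrightarrow> x = 0"
  using equivalent by (simp add: equivalent_norm_def)

lemma zero [simp]: "N 0 = 0"
  by (simp add: zero_iff)

lemma scale: "N (t *\<^sub>R x) = \<bar>t\<bar> * N x"
  using equivalent by (simp add: equivalent_norm_def)

lemma triangle: "N (x + y) \<le> N x + N y"
  using equivalent by (simp add: equivalent_norm_def)

lemma minus [simp]: "N (- x) = N x"
  using scale[of "-1" x] by simp

lemma minus_commute: "N (x - y) = N (y - x)"
  using minus[of "x - y"] by simp

lemma nonneg [simp]: "0 \<le> N x"
  using triangle[of x "- x"] by simp

lemma pos_iff: "0 < N x \<longleftrightarrow> x \<noteq> 0"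
  using nonneg[of x] zero_iff[of x] by linarith

lemma triangle_diff: "N (x - z) \<le> N (x - y) + N (y - z)"
  using triangle[of "x - y" "y - z"] by simp

lemma sum_le: "N (\<Sum>i\<in>I. x i) \<le> (\<Sum>i\<in>I. N (x i))"
proof (induction I rule: infinite_finite_induct)
  case (insert i I)
  then show ?case using triangle[of "x i" "sum x I"] by simp
qed auto

lemma bounds:
  obtains a b where "a > 0" "b > 0" "\<And>x. a * norm x \<le> N x" "\<And>x. N x \<le> b * norm x"
  using equivalent unfolding equivalent_norm_def by blast

lemma continuous_on_norm: "continuous_on A N"
proof -
  obtain b where b: "b > 0" "\<And>x. N x \<le> b * norm x" using bounds by metis
  have "\<bar>N x - N y\<bar> \<le> b * dist x y" for x y
    using triangle[of "x - y" y] triangle[of "y - x" x] b(2)[of "x - y"] minus_commute[of x y]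
    by (simp add: dist_norm abs_le_iff)
  then have "b-lipschitz_on A N"
    using b by (intro lipschitz_onI) (auto simp: dist_real_def)
  then show ?thesis by (rule lipschitz_on_continuous_on)
qed

lemma zero_in_unit_ball: "0 \<in> unit_ball N"
  by (simp add: unit_ball_def)

lemma bounded_unit_ball: "bounded (unit_ball N)"
proof -
  obtain a where a: "a > 0" "\<And>x. a * norm x \<le> N x" using bounds by metis
  have "norm x \<le> 1 / a" if "N x \<le> 1" for x
    using a(1) a(2)[of x] that by (simp add: field_simps)
  then show ?thesis by (auto simp: bounded_iff unit_ball_def)
qed

lemma closed_unit_ball: "closed (unit_ball N)"
  unfolding unit_ball_def using continuous_on_norm by (intro closed_Collect_le) auto

lemma convex_unit_ball: "convex (unit_ball N)"
proof (rule convexI)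
  fix x y :: 'a and u v :: real
  assume *: "x \<in> unit_ball N" "y \<in> unit_ball N" "0 \<le> u" "0 \<le> v" "u + v = 1"
  have "N (u *\<^sub>R x + v *\<^sub>R y) \<le> u * N x + v * N y"
    using triangle[of "u *\<^sub>R x" "v *\<^sub>R y"] * by (simp add: scale)
  also have "\<dots> \<le> u * 1 + v * 1"
    using * by (intro add_mono mult_left_mono) (auto simp: unit_ball_def)
  finally show "u *\<^sub>R x + v *\<^sub>R y \<in> unit_ball N" using * by (simp add: unit_ball_def)
qed

lemma norm_diameter_le:
  assumes "0 \<le> \<delta>" "\<And>x y. x \<in> S \<Longrightarrow> y \<in> S \<Longrightarrow> N (x - y) \<le> \<delta>"
  shows "norm_diameter N S \<le> \<delta>"
  using assms by (auto simp: norm_diameter_def intro!: cSUP_least)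

lemma le_norm_diameter:
  assumes "S \<subseteq> unit_ball N" "x \<in> S" "y \<in> S"
  shows "N (x - y) \<le> norm_diameter N S"
proof -
  have "N (u - v) \<le> 2" if "u \<in> S" "v \<in> S" for u v
  proof -
    have "N u \<le> 1" "N v \<le> 1" using that assms(1) by (auto simp: unit_ball_def)
    then show ?thesis using triangle[of u "- v"] by simp
  qed
  then have "bdd_above ((\<lambda>(x, y). N (x - y)) ` (S \<times> S))"
    by (intro bdd_aboveI2[where M = 2]) auto
  then have "(case (x, y) of (x, y) \<Rightarrow> N (x - y)) \<le> (SUP (x, y)\<in>S \<times> S. N (x - y))"
    using assms by (intro cSUP_upper) auto
  then show ?thesis using assms by (auto simp: norm_diameter_def)
qed

lemma norm_diameter_le_diameter:
  assumes "bounded S" "T \<subseteq> S" "b > 0" "\<And>x. N x \<le> b * norm x"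
  shows "norm_diameter N T \<le> b * diameter S"
proof (rule norm_diameter_le)
  show "0 \<le> b * diameter S" using assms by (simp add: diameter_ge_0)
  fix x y assume "x \<in> T" "y \<in> T"
  then have "norm (x - y) \<le> diameter S"
    using diameter_bounded_bound[of S x y] assms by (auto simp: dist_norm)
  then show "N (x - y) \<le> b * diameter S"
    using assms by (meson order_trans mult_left_mono less_imp_le)
qed

lemma unit_sphere_subset: "unit_sphere N \<subseteq> unit_ball N"
  by (auto simp: unit_sphere_def unit_ball_def)

text \<open>The upper bound on \<open>D\<close> alone gives continuity: applied at
  \<open>- x\<close> it bounds \<open>D\<close> from below.\<close>

lemma linear_imp_blinfun:
  assumes "linear D" "\<And>x. D x \<le> L * N x" "L \<ge> 0"
  obtains g :: "'a \<Rightarrow>\<^sub>L real" where "\<And>x. g x = D x"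
proof -
  obtain b where b: "\<And>x. N x \<le> b * norm x" using bounds by metis
  have "\<bar>D x\<bar> \<le> norm x * (L * b)" for x
  proof -
    have "\<bar>D x\<bar> \<le> L * N x"
      using assms(2)[of x] assms(2)[of "- x"] linear_neg[OF assms(1), of x] by simp
    also have "\<dots> \<le> L * (b * norm x)" using b assms(3) by (intro mult_left_mono)
    finally show ?thesis by (simp add: ac_simps)
  qed
  with assms(1) have "bounded_linear D"
    by (intro bounded_linear_intro[where K = "L * b"]) (auto simp: linear_add linear_cmul)
  then show thesis using that[of "Blinfun D"] by (simp add: bounded_linear_Blinfun_apply)
qed

section \<open>Norming functionals and the dual norm\<close>

lemma sublinear_norm: "sublinear N"
  by (rule sublinearI) (auto simp: triangle scale)

lemma norming_functional:
  obtains g :: "'a \<Rightarrow>\<^sub>L real" where "\<And>y. g y \<le> N y" "g x = N x"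
proof -
  obtain D where D: "linear D" "\<And>y. D y \<le> N y" "D x = N x"
    using hahn_banach[OF sublinear_norm] by blast
  then obtain g :: "'a \<Rightarrow>\<^sub>L real" where "\<And>y. g y = D y"
    using linear_imp_blinfun[of D 1] by auto
  with D that show thesis by metis
qed

text \<open>By symmetry of the ball the supremum may be taken without absolute values. In this form
  it is literally the supremum in the definition of \<open>slice\<close> for
  \<open>C = unit_ball N\<close>.\<close>

definition dual_norm :: "('a \<Rightarrow>\<^sub>L real) \<Rightarrow> real" where
  "dual_norm g = (SUP y\<in>unit_ball N. g y)"

lemma le_dual_norm_ball: "N x \<le> 1 \<Longrightarrow> blinfun_apply g x \<le> dual_norm g"
  unfolding dual_norm_def
  by (intro cSUP_upper bdd_above_blinfun_image bounded_unit_ball) (simp add: unit_ball_def)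

lemma dual_norm_le: "(\<And>x. N x \<le> 1 \<Longrightarrow> blinfun_apply g x \<le> K) \<Longrightarrow> dual_norm g \<le> K"
  unfolding dual_norm_def
proof (rule cSUP_least)
  show "unit_ball N \<noteq> {}" using zero_in_unit_ball by blast
qed (simp add: unit_ball_def)

lemma le_dual_norm: "blinfun_apply g x \<le> dual_norm g * N x"
proof (cases "x = 0")
  case False
  then have "N x > 0" by (simp add: pos_iff)
  then have "g (x /\<^sub>R N x) \<le> dual_norm g"
    by (intro le_dual_norm_ball) (simp add: scale)
  with \<open>N x > 0\<close> show ?thesis by (simp add: blinfun.scaleR_right field_simps)
qed (simp add: blinfun.zero_right)

lemma dual_norm_nonneg: "0 \<le> dual_norm g"
  using le_dual_norm_ball[of 0 g] by (simp add: blinfun.zero_right)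

lemma dual_norm_pos:
  assumes "g \<noteq> 0" shows "0 < dual_norm g"
proof -
  obtain x where "g x \<noteq> 0" using assms by (metis blinfun_eqI zero_blinfun.rep_eq)
  then have "0 < g x \<or> 0 < g (- x)" by (auto simp: blinfun.minus_right)
  then obtain y where "0 < g y" by blast
  with le_dual_norm[of g y] have "0 < dual_norm g * N y" by simp
  then show ?thesis using dual_norm_nonneg[of g] by (auto simp: zero_less_mult_iff)
qed

lemma abs_le_dual_norm: "\<bar>blinfun_apply g x\<bar> \<le> dual_norm g * N x"
  using le_dual_norm[of g x] le_dual_norm[of g "- x"] by (simp add: blinfun.minus_right)

section \<open>Lipschitz constants, Lip-slices and the Lip-topology\<close>

lemma lipschitz_const_bound:
  assumes "norm_lipschitz N f"
  shows "\<bar>f x - f y\<bar> \<le> lipschitz_const N f * N (x - y)"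
proof (cases "x = y")
  case False
  then have pos: "N (x - y) > 0" by (simp add: pos_iff)
  have "\<bar>f x - f y\<bar> / N (x - y) \<le> lipschitz_const N f"
    unfolding lipschitz_const_def
    using assms pos by (intro cInf_greatest) (auto simp: norm_lipschitz_def field_simps)
  with pos show ?thesis by (simp add: field_simps)
qed simp

lemma lipschitz_const_nonneg: "norm_lipschitz N f \<Longrightarrow> 0 \<le> lipschitz_const N f"
  unfolding lipschitz_const_def norm_lipschitz_def
  by (rule cInf_greatest) blast+

lemma norm_lipschitz_blinfun: "norm_lipschitz N (blinfun_apply g)"
  unfolding norm_lipschitz_def
proof (intro exI conjI allI)
  show "\<bar>g x - g y\<bar> \<le> dual_norm g * N (x - y)" for x y
    using abs_le_dual_norm[of g "x - y"] by (simp add: blinfun.diff_right)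
qed (rule dual_norm_nonneg)

lemma lipschitz_const_blinfun: "lipschitz_const N (blinfun_apply g) = dual_norm g"
  unfolding lipschitz_const_def
proof (rule cInf_eq_minimum)
  show "dual_norm g \<in> {L. 0 \<le> L \<and> (\<forall>x y. \<bar>blinfun_apply g x - blinfun_apply g y\<bar> \<le> L * N (x - y))}"
    using abs_le_dual_norm dual_norm_nonneg by (simp flip: blinfun.diff_right)
  fix L assume "L \<in> {L. 0 \<le> L \<and> (\<forall>x y. \<bar>blinfun_apply g x - blinfun_apply g y\<bar> \<le> L * N (x - y))}"
  then have L: "0 \<le> L" "\<And>x y. \<bar>g x - g y\<bar> \<le> L * N (x - y)" by auto
  show "dual_norm g \<le> L"
  proof (rule dual_norm_le)
    fix x assume "N x \<le> 1"
    then have "L * N x \<le> L * 1" using L(1) by (intro mult_left_mono)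
    then show "g x \<le> L" using L(2)[of x 0] by (simp add: blinfun.zero_right)
  qed
qed

lemma lip_slice_subset: "lip_slice N f \<epsilon> \<subseteq> unit_sphere N"
proof
  fix z assume "z \<in> lip_slice N f \<epsilon>"
  then obtain x y where "x \<noteq> y" "z = (x - y) /\<^sub>R N (x - y)"
    unfolding lip_slice_def by blast
  moreover from this have "N (x - y) > 0" by (simp add: pos_iff)
  ultimately show "z \<in> unit_sphere N" by (simp add: unit_sphere_def scale)
qed

lemma lip_slices_subset: "S \<in> lip_slices N \<Longrightarrow> S \<subseteq> unit_sphere N"
  using lip_slice_subset by (auto simp: lip_slices_def)

text \<open>The slope of a linear functional along a segment depends only on the direction, and a
  unit vector \<open>a\<close> is the direction of the segment from 0 to \<open>a\<close>.\<close>

lemma lip_slice_blinfun: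
  fixes g :: "'a \<Rightarrow>\<^sub>L real"
  shows "lip_slice N (blinfun_apply g) \<epsilon> = {a. N a = 1 \<and> blinfun_apply g a > dual_norm g - \<epsilon>}"
proof (intro equalityI subsetI)
  fix a assume "a \<in> lip_slice N (blinfun_apply g) \<epsilon>"
  then show "a \<in> {a. N a = 1 \<and> blinfun_apply g a > dual_norm g - \<epsilon>}"
    using lip_slice_subset[of "blinfun_apply g" \<epsilon>]
    by (auto simp: lip_slice_def lipschitz_const_blinfun unit_sphere_def
        blinfun.scaleR_right blinfun.diff_right divide_inverse mult.commute)
next
  fix a assume a: "a \<in> {a. N a = 1 \<and> blinfun_apply g a > dual_norm g - \<epsilon>}"
  then show "a \<in> lip_slice N (blinfun_apply g) \<epsilon>"
    unfolding lip_slice_def lipschitz_const_blinfun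
    by (intro CollectI exI[of _ a] exI[of _ 0]) (auto simp: blinfun.zero_right)
qed

text \<open>The width \<open>dual_norm g - c\<close> yields the threshold \<open>c\<close>; the
  point \<open>x\<close> makes this width positive and the Lip-slice non-empty.\<close>

lemma halfspace_in_lip_slices:
  fixes g :: "'a \<Rightarrow>\<^sub>L real"
  assumes "N x = 1" "blinfun_apply g x > c"
  shows "{a. N a = 1 \<and> blinfun_apply g a > c} \<in> lip_slices N"
proof -
  have "lip_slice N g (dual_norm g - c) = {a. N a = 1 \<and> g a > c}"
    by (simp add: lip_slice_blinfun)
  moreover have "dual_norm g - c > 0" using assms le_dual_norm_ball[of x g] by simp
  ultimately show ?thesis
    using assms norm_lipschitz_blinfun[of g] unfolding lip_slices_def by blast
qed

text \<open>The supremum of the slopes of \<open>f\<close> in a direction is a sublinear function of the direction,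
  so it dominates a linear functional that agrees with it at \<open>x\<close>.\<close>

lemma lip_slice_halfspace:
  assumes f: "norm_lipschitz N f" and x: "x \<in> lip_slice N f \<epsilon>"
  obtains g :: "'a \<Rightarrow>\<^sub>L real" and c where "g x > c"
    "\<And>a. N a = 1 \<Longrightarrow> g a > c \<Longrightarrow> a \<in> lip_slice N f \<epsilon>"
proof -
  define L where "L = lipschitz_const N f"
  have L: "L \<ge> 0" "\<And>x y. f x - f y \<le> L * N (x - y)"
    unfolding L_def using lipschitz_const_nonneg[OF f] lipschitz_const_bound[OF f]
    by (auto simp: abs_le_iff)
  define p where "p a = (SUP (y, t)\<in>UNIV \<times> {0<..}. (f (y + t *\<^sub>R a) - f y) / t)" for a
  have bound: "(f (y + t *\<^sub>R a) - f y) / t \<le> L * N a" if "t > 0" for y t a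
    using L(2)[of "y + t *\<^sub>R a" y] that by (simp add: scale field_simps)
  have bdd: "bdd_above ((\<lambda>(y, t). (f (y + t *\<^sub>R a) - f y) / t) ` (UNIV \<times> {0<..}))" for a
    using bound by (intro bdd_aboveI2[where M = "L * N a"]) auto
  have upper: "(f (y + t *\<^sub>R a) - f y) / t \<le> p a" if "t > 0" for y t a
    unfolding p_def using cSUP_upper[OF _ bdd, of "(y, t)" a] that by auto
  have least: "p a \<le> K" if "\<And>y t. t > 0 \<Longrightarrow> (f (y + t *\<^sub>R a) - f y) / t \<le> K" for a K
    unfolding p_def using that by (intro cSUP_least) (auto intro: exI[of _ 1])
  have "sublinear p"
  proof (rule sublinearI)
    show "p (a + b) \<le> p a + p b" for a b
    proof (rule least)
      fix y :: 'a and t :: real assume "t > 0"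
      \<comment> \<open>The point \<open>y + t *\<^sub>R a\<close> splits the segment into one of
        direction \<open>a\<close> and one of direction \<open>b\<close>; the increments of
        \<open>f\<close> add up.\<close>
      then show "(f (y + t *\<^sub>R (a + b)) - f y) / t \<le> p a + p b"
        using upper[of t y a] upper[of t "y + t *\<^sub>R a" b]
        by (simp add: scaleR_right_distrib add.assoc diff_divide_distrib)
    qed
    have "p 0 \<le> 0" by (rule least) simp
    then show "p 0 = 0" using upper[of 1 0 0] by simp
    show "p (r *\<^sub>R a) \<le> r * p a" if r: "r > 0" for r a
    proof (rule least)
      fix y :: 'a and t :: real assume t: "t > 0"
      have "(f (y + t *\<^sub>R r *\<^sub>R a) - f y) / t = r * ((f (y + (t * r) *\<^sub>R a) - f y) / (t * r))"
        using r by simp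
      also have "\<dots> \<le> r * p a"
        using upper[of "t * r" y a] r t by (intro mult_left_mono) auto
      finally show "(f (y + t *\<^sub>R r *\<^sub>R a) - f y) / t \<le> r * p a" .
    qed
  qed
  then obtain D where D: "linear D" "\<And>y. D y \<le> p y" "D x = p x"
    using hahn_banach by blast
  have "D a \<le> L * N a" for a
    using D(2)[of a] least[OF bound, of a] by simp
  then obtain g :: "'a \<Rightarrow>\<^sub>L real" where g: "\<And>y. g y = D y"
    using linear_imp_blinfun[OF D(1) _ L(1)] by blast
  obtain u v where uv: "u \<noteq> v" "x = (u - v) /\<^sub>R N (u - v)" "(f u - f v) / N (u - v) > L - \<epsilon>"
    using x by (auto simp: lip_slice_def L_def)
  \<comment> \<open>With this length the segment from \<open>v\<close> to \<open>u\<close> has the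
    form used in \<open>p\<close>, so its slope is at most \<open>p x\<close>, which is the value
    \<open>D x\<close>.\<close>
  define t where "t = N (u - v)"
  have t: "t > 0" using uv(1) by (simp add: t_def pos_iff)
  then have "v + t *\<^sub>R x = u" using uv(2) by (simp add: t_def)
  then have "g x > L - \<epsilon>"
    using upper[OF t, of v x] uv(3) by (simp add: g D(3) t_def)
  moreover have "a \<in> lip_slice N f \<epsilon>" if a: "N a = 1" "g a > L - \<epsilon>" for a
  proof -
    have "\<not> p a \<le> L - \<epsilon>" using a(2) D(2)[of a] by (simp add: g)
    then obtain y s where s: "s > 0" "(f (y + s *\<^sub>R a) - f y) / s > L - \<epsilon>"
      using least[of a "L - \<epsilon>"] by (metis not_le)
    have "a \<noteq> 0" using a(1) by auto
    then show ?thesis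
      unfolding lip_slice_def using s a(1)
      by (intro CollectI exI[of _ "y + s *\<^sub>R a"] exI[of _ y]) (auto simp: scale L_def)
  qed
  ultimately show thesis by (rule that)
qed

lemma lip_slices_halfspace:
  assumes "S \<in> lip_slices N" "x \<in> S"
  obtains g :: "'a \<Rightarrow>\<^sub>L real" and c where "g x > c" "\<And>a. N a = 1 \<Longrightarrow> g a > c \<Longrightarrow> a \<in> S"
  using assms lip_slice_halfspace unfolding lip_slices_def by blast

lemma slice_in_lip_slices:
  assumes "g \<noteq> 0" "\<alpha> > 0"
  shows "slice (unit_ball N) g \<alpha> \<inter> unit_sphere N \<in> lip_slices N"
proof -
  have eq: "slice (unit_ball N) g \<alpha> \<inter> unit_sphere N = {a. N a = 1 \<and> blinfun_apply g a > dual_norm g - \<alpha>}"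
    by (auto simp: slice_def unit_ball_def unit_sphere_def dual_norm_def)
  \<comment> \<open>The smaller width makes \<open>g\<close> positive on the slice. Normalising a
    point of the slice then does not decrease \<open>g\<close>, so the slice reaches the
    sphere.\<close>
  define \<beta> where "\<beta> = min \<alpha> (dual_norm g)"
  have \<beta>: "\<beta> > 0" "\<beta> \<le> \<alpha>" "dual_norm g - \<beta> \<ge> 0"
    using assms dual_norm_pos by (auto simp: \<beta>_def)
  obtain x where x: "x \<in> slice (unit_ball N) g \<beta>"
    using slice_nonempty[OF _ \<beta>(1), of "unit_ball N" g] zero_in_unit_ball by blast
  then have x: "N x \<le> 1" "g x > dual_norm g - \<beta>"
    by (auto simp: slice_def unit_ball_def dual_norm_def)
  then have "g x > 0" using \<beta> by simp
  then have "x \<noteq> 0" by (auto simp: blinfun.zero_right)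
  then have "N x > 0" by (simp add: pos_iff)
  have "g x \<le> g x / N x"
    using x(1) \<open>N x > 0\<close> \<open>g x > 0\<close> by (simp add: field_simps)
  then have "g (x /\<^sub>R N x) > dual_norm g - \<alpha>"
    using x(2) \<beta>(2) by (simp add: blinfun.scaleR_right divide_inverse_commute)
  then show ?thesis
    unfolding eq using \<open>N x > 0\<close> by (intro halfspace_in_lip_slices[of "x /\<^sub>R N x"]) (simp add: scale)
qed

lemma lip_slices_contain_slice:
  assumes S: "S \<in> lip_slices N" and nontriv: "\<exists>x::'a. x \<noteq> 0"
  obtains g \<alpha> where "g \<noteq> 0" "\<alpha> > 0" "slice (unit_ball N) g \<alpha> \<inter> unit_sphere N \<subseteq> S"
proof -
  obtain x where x: "x \<in> S" using S by (auto simp: lip_slices_def)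
  obtain g :: "'a \<Rightarrow>\<^sub>L real" and c where g: "g x > c" "\<And>a. N a = 1 \<Longrightarrow> g a > c \<Longrightarrow> a \<in> S"
    using lip_slices_halfspace[OF S x] by blast
  show thesis
  proof (cases "g = 0")
    case True
    \<comment> \<open>Here \<open>c < 0\<close>, so \<open>S\<close> is the whole sphere and any
      non-zero functional will do; a non-zero vector is required to find one.\<close>
    obtain z :: 'a where "z \<noteq> 0" using nontriv by blast
    obtain h :: "'a \<Rightarrow>\<^sub>L real" where "h z = N z" using norming_functional[of z] by blast
    with \<open>z \<noteq> 0\<close> have "h \<noteq> 0" by (auto simp: zero_iff)
    with True g show thesis by (intro that[of h 1]) (auto simp: unit_sphere_def)
  next
    case False
    have "N x = 1" using lip_slices_subset[OF S] x by (auto simp: unit_sphere_def)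
    then have "dual_norm g - c > 0" using g(1) le_dual_norm_ball[of x g] by simp
    with False g(2) show thesis
      by (intro that[of g "dual_norm g - c"]) (auto simp: slice_def unit_sphere_def dual_norm_def)
  qed
qed

text \<open>Together with \<open>openin_lip_halfspaces\<close> this identifies the Lip-topology with
  the weak topology of the sphere: each of the finitely many Lip-slices around \<open>x\<close>
  contains the trace of an open half-space containing \<open>x\<close>.\<close>

lemma lip_nbhd:
  assumes U: "openin (lip_topology N) U" and x: "x \<in> U"
  shows "x \<in> unit_sphere N" "weakly_near (unit_sphere N) x (\<lambda>a. a \<in> U)"
proof -
  obtain \<F> where \<F>: "finite \<F>" "\<F> \<noteq> {}" "\<F> \<subseteq> lip_slices N" "x \<in> \<Inter>\<F>" "\<Inter>\<F> \<subseteq> U"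
    by (rule openin_topology_generated_by_finite_Inter[OF U[unfolded lip_topology_def] x])
  have "weakly_near (unit_sphere N) x (\<lambda>a. a \<in> W)"
    if "W \<in> \<F>" for W
  proof -
    have W: "W \<in> lip_slices N" "x \<in> W" using that \<F> by auto
    obtain g :: "'a \<Rightarrow>\<^sub>L real" and c where g: "g x > c" "\<And>a. N a = 1 \<Longrightarrow> g a > c \<Longrightarrow> a \<in> W"
      using lip_slices_halfspace[OF W] by blast
    then show ?thesis
      by (intro weakly_nearI[of "{g}" "g x - c"]) (auto simp: unit_sphere_def)
  qed
  then have "weakly_near (unit_sphere N) x (\<lambda>a. \<forall>W\<in>\<F>. a \<in> W)"
    by (intro weakly_near_finite[OF \<F>(1)])
  moreover have "a \<in> U" if "\<forall>W\<in>\<F>. a \<in> W" for a using that \<F>(5) by blast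
  ultimately show "weakly_near (unit_sphere N) x (\<lambda>a. a \<in> U)"
    by (rule weakly_near_mono)
  show "x \<in> unit_sphere N" using \<F>(2,3,4) lip_slices_subset by blast
qed

lemma openin_lip_halfspaces:
  fixes F :: "('a \<Rightarrow>\<^sub>L real) set"
  assumes "finite F" "N x = 1" "\<And>g. g \<in> F \<Longrightarrow> blinfun_apply g x > c g"
  shows "openin (lip_topology N) {a. N a = 1 \<and> (\<forall>g\<in>F. blinfun_apply g a > c g)}"
  using assms(1,3)
proof (induction F)
  case empty
  have "{a. N a = 1 \<and> blinfun_apply (0 :: 'a \<Rightarrow>\<^sub>L real) a > -1} \<in> lip_slices N"
    using assms(2) by (intro halfspace_in_lip_slices[of x]) (auto simp: blinfun.zero_left)
  then show ?case unfolding lip_topology_def by (intro topology_generated_by_Basis) simp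
next
  case (insert g F)
  have "openin (lip_topology N) {a. N a = 1 \<and> blinfun_apply g a > c g}"
    unfolding lip_topology_def using assms(2) insert.prems
    by (intro topology_generated_by_Basis halfspace_in_lip_slices[of x]) auto
  with insert have "openin (lip_topology N) ({a. N a = 1 \<and> blinfun_apply g a > c g} \<inter>
      {a. N a = 1 \<and> (\<forall>g\<in>F. blinfun_apply g a > c g)})"
    by (intro openin_Int) auto
  then show ?case by (rule back_subst[of "openin (lip_topology N)"]) auto
qed

end

text \<open>An approximate projection onto the common kernel, whose displacement is controlled by
  the values of the functionals. If the kernel is trivial, \<open>P\<close> vanishes and the
  functionals control the norm.\<close>

lemma near_projection_onto_kernel:
  fixes F :: "('a::real_normed_vector \<Rightarrow>\<^sub>L real) set"
  assumes "finite F"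
  obtains P :: "'a \<Rightarrow> 'a" and K where "K \<ge> 0" "\<And>y g. g \<in> F \<Longrightarrow> blinfun_apply g (P y) = 0"
    "\<And>y. norm (y - P y) \<le> K * (\<Sum>g\<in>F. \<bar>blinfun_apply g y\<bar>)"
proof -
  have "\<exists>(P :: 'a \<Rightarrow> 'a) K. K \<ge> 0 \<and> (\<forall>y. \<forall>g\<in>F. blinfun_apply g (P y) = 0) \<and>
    (\<forall>y. norm (y - P y) \<le> K * (\<Sum>g\<in>F. \<bar>blinfun_apply g y\<bar>))"
    using assms
  proof (induction F)
    case empty
    show ?case by (intro exI[of _ id] exI[of _ 0]) auto
  next
    case (insert h F)
    then obtain P :: "'a \<Rightarrow> 'a" and K where P: "K \<ge> 0"
      "\<And>y g. g \<in> F \<Longrightarrow> blinfun_apply g (P y) = 0"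
      "\<And>y. norm (y - P y) \<le> K * (\<Sum>g\<in>F. \<bar>blinfun_apply g y\<bar>)"
      by auto
    show ?case
    proof (cases "\<forall>v. (\<forall>g\<in>F. blinfun_apply g v = 0) \<longrightarrow> blinfun_apply h v = 0")
      case True
      have "norm (y - P y) \<le> K * (\<Sum>g\<in>insert h F. \<bar>blinfun_apply g y\<bar>)" for y
      proof -
        have "K * (\<Sum>g\<in>F. \<bar>blinfun_apply g y\<bar>) \<le> K * (\<Sum>g\<in>insert h F. \<bar>blinfun_apply g y\<bar>)"
          using insert.hyps P(1) by (intro mult_left_mono sum_mono2) auto
        with P(3)[of y] show ?thesis by linarith
      qed
      with True P(1,2) show ?thesis by (intro exI[of _ P] exI[of _ K]) auto
    next
      case False
      then obtain v where v: "\<And>g. g \<in> F \<Longrightarrow> blinfun_apply g v = 0" "blinfun_apply h v \<noteq> 0" by blast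
      \<comment> \<open>\<open>e\<close> lies in the kernel for \<open>F\<close> and satisfies
        \<open>h e = 1\<close>, so subtracting a multiple of it corrects \<open>h\<close> without
        disturbing the earlier functionals.\<close>
      define e where "e = v /\<^sub>R blinfun_apply h v"
      have e: "blinfun_apply h e = 1" "\<And>g. g \<in> F \<Longrightarrow> blinfun_apply g e = 0"
        using v by (simp_all add: e_def blinfun.scaleR_right)
      define Q where "Q y = P y - blinfun_apply h (P y) *\<^sub>R e" for y
      \<comment> \<open>The correction has size \<open>\<bar>h (P y)\<bar> * norm e\<close>, and
        \<open>\<bar>h (P y)\<bar>\<close> exceeds \<open>\<bar>h y\<bar>\<close> by at most
        \<open>norm h\<close> times the displacement of \<open>P\<close>.\<close>
      define K' where "K' = K + norm e * (1 + norm h * K)"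
      have K': "K' \<ge> 0" using P(1) by (simp add: K'_def)
      have "blinfun_apply g (Q y) = 0" if "g \<in> insert h F" for g y
        using that e P(2) by (auto simp: Q_def blinfun.diff_right blinfun.scaleR_right)
      moreover have "norm (y - Q y) \<le> K' * (\<Sum>g\<in>insert h F. \<bar>blinfun_apply g y\<bar>)" for y
      proof -
        define \<Sigma> where "\<Sigma> = (\<Sum>g\<in>F. \<bar>blinfun_apply g y\<bar>)"
        have \<Sigma>: "0 \<le> \<Sigma>" "norm (y - P y) \<le> K * \<Sigma>" using P(3) by (auto simp: \<Sigma>_def sum_nonneg)
        have "blinfun_apply h (P y) = blinfun_apply h y - blinfun_apply h (y - P y)"
          by (simp add: blinfun.diff_right)
        then have "\<bar>blinfun_apply h (P y)\<bar> \<le> \<bar>blinfun_apply h y\<bar> + norm h * norm (y - P y)"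
          using norm_blinfun[of h "y - P y"] by simp
        also have "\<dots> \<le> \<bar>blinfun_apply h y\<bar> + norm h * (K * \<Sigma>)"
          using \<Sigma> by (intro add_left_mono mult_left_mono) auto
        finally have h: "\<bar>blinfun_apply h (P y)\<bar> \<le> \<bar>blinfun_apply h y\<bar> + norm h * (K * \<Sigma>)" .
        have "norm (y - Q y) \<le> norm (y - P y) + \<bar>blinfun_apply h (P y)\<bar> * norm e"
          using norm_triangle_ineq[of "y - P y" "blinfun_apply h (P y) *\<^sub>R e"]
          by (simp add: Q_def diff_diff_eq2 add_diff_eq diff_add_eq)
        also have "\<dots> \<le> K * \<Sigma> + (\<bar>blinfun_apply h y\<bar> + norm h * (K * \<Sigma>)) * norm e"
          using h \<Sigma> by (intro add_mono mult_right_mono) auto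
        also have "\<dots> \<le> K' * (\<bar>blinfun_apply h y\<bar> + \<Sigma>)"
        proof -
          have "0 \<le> norm e * \<Sigma>" "0 \<le> K * \<bar>blinfun_apply h y\<bar>"
            "0 \<le> norm e * (norm h * K) * \<bar>blinfun_apply h y\<bar>"
            using P(1) \<Sigma>(1) by auto
          then show ?thesis by (simp add: K'_def algebra_simps)
        qed
        finally show ?thesis using insert.hyps by (simp add: \<Sigma>_def)
      qed
      ultimately show ?thesis using K' by (intro exI[of _ Q] exI[of _ K']) auto
    qed
  qed
  with that show thesis by blast
qed

section \<open>From RNP, strong regularity and CPCP to small sets on the sphere\<close>

context equiv_norm
begin

text \<open>Diameters in \<open>RNP\<close> refer to \<open>norm\<close>, so the tolerance is
  divided by \<open>b\<close>. Passing to the trace on the sphere leaves a Lip-slice and can only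
  shrink the set.\<close>

lemma small_lip_slice_if_RNP:
  assumes "RNP TYPE('a)" "\<delta> > 0"
  shows "\<exists>S\<in>lip_slices N. S \<subseteq> unit_sphere N \<and> norm_diameter N S < \<delta>"
proof -
  obtain b where b: "b > 0" "\<And>x. N x \<le> b * norm x" using bounds by metis
  have "unit_ball N \<noteq> {}" using zero_in_unit_ball by blast
  moreover have "\<delta> / b > 0" using assms(2) b by simp
  ultimately obtain S where S: "S \<in> slices (unit_ball N)" "diameter S < \<delta> / b"
    using assms(1) closed_unit_ball bounded_unit_ball convex_unit_ball unfolding RNP_def by metis
  then obtain f \<alpha> where f: "S = slice (unit_ball N) f \<alpha>" "f \<noteq> 0" "\<alpha> > 0"
    by (auto simp: slices_def)
  have "bounded S" using bounded_subset[OF bounded_unit_ball] slice_subset f(1) by metis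
  then have "norm_diameter N (S \<inter> unit_sphere N) \<le> b * diameter S"
    using b by (intro norm_diameter_le_diameter) auto
  also have "\<dots> < \<delta>" using S(2) b by (simp add: field_simps)
  finally show ?thesis using slice_in_lip_slices[OF f(2,3)] f(1) by blast
qed

lemma small_convex_combination_if_strongly_regular:
  assumes "strongly_regular TYPE('a)" "\<delta> > 0"
  shows "\<exists>S\<in>convex_combinations (lip_slices N). S \<subseteq> unit_ball N \<and> norm_diameter N S < \<delta>"
proof -
  obtain b where b: "b > 0" "\<And>x. N x \<le> b * norm x" using bounds by metis
  have "unit_ball N \<noteq> {}" using zero_in_unit_ball by blast
  moreover have "\<delta> / b > 0" using assms(2) b by simp
  ultimately obtain S where S: "S \<in> convex_combinations (slices (unit_ball N))" "diameter S < \<delta> / b"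
    using assms(1) closed_unit_ball bounded_unit_ball convex_unit_ball
    unfolding strongly_regular_def by metis
  obtain n :: nat and c P where P: "S = {\<Sum>i=1..n. c i *\<^sub>R s i |s. \<forall>i\<in>{1..n}. s i \<in> P i}"
    "n \<ge> 1" "\<forall>i\<in>{1..n}. c i \<ge> 0 \<and> P i \<in> slices (unit_ball N)" "(\<Sum>i=1..n. c i) = 1"
    using S(1) by (rule convex_combinationsE)
  define Q where "Q i = P i \<inter> unit_sphere N" for i
  define T where "T = {\<Sum>i=1..n. c i *\<^sub>R s i |s. \<forall>i\<in>{1..n}. s i \<in> Q i}"
  have Q: "Q i \<in> lip_slices N" "P i \<subseteq> unit_ball N" if i: "i \<in> {1..n}" for i
  proof -
    have "P i \<in> slices (unit_ball N)" using P(3) i by blast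
    then obtain f \<alpha> where f: "P i = slice (unit_ball N) f \<alpha>" "f \<noteq> 0" "\<alpha> > 0"
      by (auto simp: slices_def)
    show "Q i \<in> lip_slices N" unfolding Q_def f(1) by (rule slice_in_lip_slices[OF f(2,3)])
    show "P i \<subseteq> unit_ball N" unfolding f(1) by (rule slice_subset)
  qed
  have T: "T \<in> convex_combinations (lip_slices N)"
    unfolding T_def by (rule convex_combinationsI[OF P(2) _ P(4)]) (use P(3) Q(1) in blast)
  have TS: "T \<subseteq> S" unfolding T_def P(1) Q_def by blast
  have SB: "S \<subseteq> unit_ball N"
  proof
    fix x assume "x \<in> S"
    then obtain s where s: "x = (\<Sum>i=1..n. c i *\<^sub>R s i)" "\<forall>i\<in>{1..n}. s i \<in> P i"
      unfolding P(1) by blast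
    have "s i \<in> unit_ball N" if "i \<in> {1..n}" for i
      using s(2) Q(2)[OF that] that by blast
    then show "x \<in> unit_ball N"
      unfolding s(1) using P(3,4) by (intro convex_sum convex_unit_ball) auto
  qed
  have "norm_diameter N T \<le> b * diameter S"
    using b TS bounded_subset[OF bounded_unit_ball SB] by (intro norm_diameter_le_diameter) auto
  also have "\<dots> < \<delta>" using S(2) b by (simp add: field_simps)
  finally have "norm_diameter N T < \<delta>" .
  with T order_trans[OF TS SB] show ?thesis by (intro bexI[of _ T]) auto
qed

lemma line_meets_unit_sphere:
  assumes "N x \<le> 1" "v \<noteq> 0"
  obtains t where "N (x + t *\<^sub>R v) = 1"
proof -
  have v: "N v > 0" using assms(2) by (simp add: pos_iff)
  \<comment> \<open>The length is chosen so that \<open>N (T *\<^sub>R v) = 1 + N x\<close>; even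
    after cancelling against \<open>x\<close> at least 1 remains, and the intermediate value theorem
    applies.\<close>
  define T where "T = (1 + N x) / N v"
  have T: "T \<ge> 0" using v by (simp add: T_def add_nonneg_nonneg)
  have "N (T *\<^sub>R v) = 1 + N x" using v T by (simp add: scale T_def)
  then have "1 \<le> N (x + T *\<^sub>R v)"
    using triangle[of "x + T *\<^sub>R v" "- x"] by simp
  moreover have "continuous_on {0..T} (\<lambda>t. N (x + t *\<^sub>R v))"
    by (intro continuous_on_compose2[OF continuous_on_norm[of UNIV]] continuous_intros) auto
  ultimately obtain t where "N (x + t *\<^sub>R v) = 1"
    using IVT'[of "\<lambda>t. N (x + t *\<^sub>R v)" 0 1 T] assms(1) T by auto
  then show thesis by (rule that)
qed

text \<open>If finitely many functionals have a common kernel vector, every weak neighbourhood they define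
  contains a line; otherwise the space is finite-dimensional and they control the norm.\<close>

lemma small_lip_open_if_CPCP:
  assumes "CPCP TYPE('a)" "\<delta> > 0" and nontriv: "\<exists>x::'a. x \<noteq> 0"
  shows "\<exists>U. openin (lip_topology N) U \<and> U \<noteq> {} \<and> U \<subseteq> unit_sphere N \<and> norm_diameter N U < \<delta>"
proof -
  obtain b where b: "b > 0" "\<And>x. N x \<le> b * norm x" using bounds by metis
  have "unit_ball N \<noteq> {}" using zero_in_unit_ball by blast
  moreover have "\<delta> / b > 0" using assms(2) b by simp
  ultimately obtain U where U: "openin (subtopology weak_topology (unit_ball N)) U" "U \<noteq> {}"
    "diameter U < \<delta> / b"
    using assms(1) closed_unit_ball bounded_unit_ball convex_unit_ball unfolding CPCP_def by metis
  have UB: "U \<subseteq> unit_ball N" using openin_imp_subset[OF U(1)] by simp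
  obtain x where x: "x \<in> U" using U(2) by blast
  obtain F :: "('a \<Rightarrow>\<^sub>L real) set" and \<eta> where F: "finite F" "\<eta> > 0"
    "\<forall>a\<in>unit_ball N. (\<forall>g\<in>F. blinfun_apply g a > blinfun_apply g x - \<eta>) \<longrightarrow> a \<in> U"
    using weak_nbhd[OF U(1) x] by (rule weakly_nearE)
  show ?thesis
  proof (cases "\<exists>v. v \<noteq> 0 \<and> (\<forall>g\<in>F. blinfun_apply g v = 0)")
    case True
    then obtain v where v: "v \<noteq> 0" "\<And>g. g \<in> F \<Longrightarrow> blinfun_apply g v = 0" by blast
    \<comment> \<open>Moving \<open>x\<close> along the kernel vector \<open>v\<close> reaches the
      sphere without changing any functional in \<open>F\<close>.\<close>
    have "N x \<le> 1" using x UB by (auto simp: unit_ball_def)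
    then obtain t where t: "N (x + t *\<^sub>R v) = 1" using line_meets_unit_sphere v(1) by blast
    have gt: "blinfun_apply g (x + t *\<^sub>R v) = blinfun_apply g x" if "g \<in> F" for g
      using v(2)[OF that] by (simp add: blinfun.add_right blinfun.scaleR_right)
    define W where "W = {a. N a = 1 \<and> (\<forall>g\<in>F. blinfun_apply g a > blinfun_apply g x - \<eta>)}"
    have "openin (lip_topology N) W"
      unfolding W_def using F(1) t by (rule openin_lip_halfspaces) (use gt F(2) in auto)
    moreover have "x + t *\<^sub>R v \<in> W" using t gt F(2) by (simp add: W_def)
    moreover have "W \<subseteq> unit_sphere N" by (auto simp: W_def unit_sphere_def)
    moreover have "norm_diameter N W < \<delta>"
    proof -
      have "W \<subseteq> U" using F(3) by (auto simp: W_def unit_ball_def)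
      then have "norm_diameter N W \<le> b * diameter U"
        using b bounded_subset[OF bounded_unit_ball UB] by (intro norm_diameter_le_diameter) auto
      also have "\<dots> < \<delta>" using U(3) b by (simp add: field_simps)
      finally show ?thesis .
    qed
    ultimately show ?thesis by blast
  next
    case False
    obtain P :: "'a \<Rightarrow> 'a" and K where P: "K \<ge> 0" "\<And>y g. g \<in> F \<Longrightarrow> blinfun_apply g (P y) = 0"
      "\<And>y. norm (y - P y) \<le> K * (\<Sum>g\<in>F. \<bar>blinfun_apply g y\<bar>)"
      using near_projection_onto_kernel[OF F(1)] by metis
    have "P y = 0" for y using False P(2) by blast
    with P(3) have K: "norm y \<le> K * (\<Sum>g\<in>F. \<bar>blinfun_apply g y\<bar>)" for y by simp
    obtain z :: 'a where "z \<noteq> 0" using nontriv by blast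
    then obtain t where t: "N (0 + t *\<^sub>R z) = 1" using line_meets_unit_sphere[of 0 z] by auto
    define y where "y = t *\<^sub>R z"
    have y: "N y = 1" using t by (simp add: y_def)
    \<comment> \<open>A deviation of \<open>\<epsilon>\<close> in each functional costs at most
      \<open>R * \<epsilon> = \<delta> / 4\<close> in \<open>N\<close>, so two such distances stay
      within \<open>\<delta> / 2\<close>. The summand 1 keeps \<open>R\<close> positive.\<close>
    define R where "R = b * (K * card F) + 1"
    have R: "R > 0" using b P(1) by (simp add: R_def add_nonneg_pos)
    define \<epsilon> where "\<epsilon> = \<delta> / (4 * R)"
    have \<epsilon>: "\<epsilon> > 0" "R * \<epsilon> = \<delta> / 4" using R assms(2) by (simp_all add: \<epsilon>_def)
    define G where "G = F \<union> uminus ` F"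
    define W where "W = {a. N a = 1 \<and> (\<forall>g\<in>G. blinfun_apply g a > blinfun_apply g y - \<epsilon>)}"
    have "openin (lip_topology N) W"
      unfolding W_def by (rule openin_lip_halfspaces[OF _ y]) (use F(1) \<epsilon>(1) in \<open>auto simp: G_def\<close>)
    moreover have "y \<in> W" using y \<epsilon>(1) by (simp add: W_def)
    moreover have "W \<subseteq> unit_sphere N" by (auto simp: W_def unit_sphere_def)
    moreover have "norm_diameter N W < \<delta>"
    proof -
      have close: "N (a - y) \<le> \<delta> / 4" if a: "a \<in> W" for a
      proof -
        have "\<bar>blinfun_apply g (a - y)\<bar> \<le> \<epsilon>" if g: "g \<in> F" for g
        proof -
          have "g \<in> G" "- g \<in> G" using g by (auto simp: G_def)
          then have "blinfun_apply g a > blinfun_apply g y - \<epsilon>"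
            "blinfun_apply (- g) a > blinfun_apply (- g) y - \<epsilon>"
            using a unfolding W_def by blast+
          then show ?thesis by (simp add: blinfun.diff_right blinfun.minus_left abs_le_iff)
        qed
        then have "(\<Sum>g\<in>F. \<bar>blinfun_apply g (a - y)\<bar>) \<le> card F * \<epsilon>"
          by (intro sum_bounded_above[where K = \<epsilon>, simplified of_nat_id])
        then have "norm (a - y) \<le> K * (card F * \<epsilon>)"
          using K[of "a - y"] P(1) by (meson mult_left_mono order_trans)
        then have "N (a - y) \<le> b * (K * (card F * \<epsilon>))"
          using b by (meson mult_left_mono order_trans less_imp_le)
        also have "\<dots> \<le> R * \<epsilon>" using \<epsilon>(1) by (simp add: R_def algebra_simps)
        finally show ?thesis by (simp add: \<epsilon>(2))
      qed
      have "norm_diameter N W \<le> \<delta> / 2"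
      proof (rule norm_diameter_le)
        fix u v assume "u \<in> W" "v \<in> W"
        then show "N (u - v) \<le> \<delta> / 2"
          using close[of u] close[of v] triangle_diff[of u v y] minus_commute[of v y] by simp
      qed (use assms(2) in simp)
      with assms(2) show ?thesis by simp
    qed
    ultimately show ?thesis by blast
  qed
qed

lemma normalize:
  assumes "y \<noteq> 0" "N y \<le> 1"
  shows "N (y /\<^sub>R N y) = 1" "N (y /\<^sub>R N y - y) = 1 - N y"
proof -
  have pos: "N y > 0" using assms(1) by (simp add: pos_iff)
  then show "N (y /\<^sub>R N y) = 1" by (simp add: scale)
  have "y /\<^sub>R N y - y = (inverse (N y) - 1) *\<^sub>R y" by (simp add: scaleR_left_diff_distrib)
  then have "N (y /\<^sub>R N y - y) = (inverse (N y) - 1) * N y"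
    using pos assms(2) by (simp add: scale one_le_inverse)
  with pos show "N (y /\<^sub>R N y - y) = 1 - N y" by (simp add: algebra_simps)
qed

text \<open>A functional that norms \<open>x\<close> keeps nearby points of the ball close to the sphere.\<close>

lemma lip_open_weakly_near:
  assumes U: "openin (lip_topology N) U" "x \<in> U" and \<kappa>: "\<kappa> > 0"
  shows "weakly_near (unit_ball N) x (\<lambda>y. \<exists>a\<in>U. N (a - y) \<le> \<kappa>)"
proof -
  have x: "N x = 1" using lip_nbhd(1)[OF U] by (simp add: unit_sphere_def)
  obtain F :: "('a \<Rightarrow>\<^sub>L real) set" and \<eta> where F: "finite F" "\<eta> > 0"
    "\<forall>a\<in>unit_sphere N. (\<forall>g\<in>F. blinfun_apply g a > blinfun_apply g x - \<eta>) \<longrightarrow> a \<in> U"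
    using lip_nbhd(2)[OF U] by (rule weakly_nearE)
  obtain f0 :: "'a \<Rightarrow>\<^sub>L real" where f0: "\<And>y. blinfun_apply f0 y \<le> N y" "blinfun_apply f0 x = N x"
    using norming_functional[of x] by blast
  define D where "D = 1 + (\<Sum>g\<in>F. dual_norm g)"
  have D: "D > 0" unfolding D_def by (intro add_pos_nonneg sum_nonneg dual_norm_nonneg) simp
  have Dg: "dual_norm g \<le> D" if "g \<in> F" for g
    using member_le_sum[of g F dual_norm] F(1) that dual_norm_nonneg by (auto simp: D_def)
  \<comment> \<open>\<open>\<kappa>\<close> bounds the distance to the sphere, 1/2 excludes
    \<open>y = 0\<close>, and \<open>\<eta> / (2 * D)\<close> limits the loss of each functional
    under normalisation to half of \<open>\<eta>\<close>. The other half is spent on the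
    neighbourhood of \<open>x\<close>.\<close>
  define \<mu> where "\<mu> = min \<kappa> (min (1/2) (\<eta> / (2 * D)))"
  have \<mu>: "\<mu> > 0" "\<mu> \<le> \<kappa>" "\<mu> < 1" "\<mu> \<le> \<eta> / (2 * D)" using \<kappa> F(2) D by (auto simp: \<mu>_def)
  then have D\<mu>: "D * \<mu> \<le> \<eta> / 2" using D by (simp add: field_simps)
  show ?thesis
  proof (rule weakly_nearI[of "insert f0 F" "min \<mu> (\<eta> / 2)"])
    show "finite (insert f0 F)" "min \<mu> (\<eta> / 2) > 0" using F \<mu> by auto
    fix y assume y: "y \<in> unit_ball N"
      "\<And>g. g \<in> insert f0 F \<Longrightarrow> blinfun_apply g y > blinfun_apply g x - min \<mu> (\<eta> / 2)"
    have Ny: "N y \<le> 1" using y(1) by (simp add: unit_ball_def)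
    have "N y > 1 - \<mu>" using y(2)[of f0] f0(1)[of y] f0(2) x by simp
    then have "y \<noteq> 0" using \<mu>(3) by auto
    define a where "a = y /\<^sub>R N y"
    have a: "N a = 1" "N (a - y) = 1 - N y"
      using normalize[OF \<open>y \<noteq> 0\<close> Ny] by (simp_all add: a_def)
    have "blinfun_apply g a > blinfun_apply g x - \<eta>" if g: "g \<in> F" for g
    proof -
      have "blinfun_apply g (y - a) \<le> dual_norm g * N (y - a)" by (rule le_dual_norm)
      also have "\<dots> \<le> D * \<mu>"
        using Dg[OF g] a(2) \<open>N y > 1 - \<mu>\<close> minus_commute[of y a] D Ny by (intro mult_mono) auto
      finally have "blinfun_apply g y - blinfun_apply g a \<le> \<eta> / 2"
        using D\<mu> by (simp add: blinfun.diff_right)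
      with y(2)[of g] g show ?thesis by simp
    qed
    then have "a \<in> U" using F(3) a(1) by (simp add: unit_sphere_def)
    moreover have "N (a - y) \<le> \<kappa>" using a(2) \<open>N y > 1 - \<mu>\<close> \<mu>(2) by simp
    ultimately show "\<exists>a\<in>U. N (a - y) \<le> \<kappa>" by blast
  qed
qed

end

subsection \<open>Gauges\<close>

definition gauge_fun :: "'a::real_normed_vector set \<Rightarrow> 'a \<Rightarrow> real" where
  "gauge_fun B x = Inf {t. t > 0 \<and> x /\<^sub>R t \<in> B}"

locale symmetric_body =
  fixes B :: "'a::real_normed_vector set" and R :: real
  assumes convex: "convex B"
    and symmetric: "x \<in> B \<Longrightarrow> - x \<in> B"
    and cball_subset: "norm x \<le> 1 \<Longrightarrow> x \<in> B"
    and norm_le: "x \<in> B \<Longrightarrow> norm x \<le> R"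
begin

lemma R_nonneg: "0 \<le> R"
  using norm_le[OF cball_subset, of 0] by simp

lemma gauge_fun_le: "t > 0 \<Longrightarrow> x /\<^sub>R t \<in> B \<Longrightarrow> gauge_fun B x \<le> t"
  unfolding gauge_fun_def by (intro cInf_lower bdd_belowI[of _ 0]) auto

lemma norm_imp_scaled_mem:
  assumes "norm x \<le> t" "t > 0"
  shows "x /\<^sub>R t \<in> B"
  by (rule cball_subset) (use assms in \<open>simp add: field_simps\<close>)

lemma le_gauge_fun:
  assumes "\<And>t. t > 0 \<Longrightarrow> x /\<^sub>R t \<in> B \<Longrightarrow> m \<le> t"
  shows "m \<le> gauge_fun B x"
  unfolding gauge_fun_def
proof (rule cInf_greatest)
  have "x /\<^sub>R (norm x + 1) \<in> B"
    by (rule norm_imp_scaled_mem) (simp_all add: add_nonneg_pos)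
  then have "norm x + 1 \<in> {t. t > 0 \<and> x /\<^sub>R t \<in> B}" by (simp add: add_nonneg_pos)
  then show "{t. t > 0 \<and> x /\<^sub>R t \<in> B} \<noteq> {}" by blast
qed (use assms in auto)

lemma gauge_fun_le_1: "x \<in> B \<Longrightarrow> gauge_fun B x \<le> 1"
  by (rule gauge_fun_le) auto

text \<open>Some admissible scale lies below 1, so \<open>x\<close> lies between 0 and a point of
  \<open>B\<close>. Strictness matters because \<open>B\<close> may miss boundary points; later
  arguments therefore shrink a vector of gauge at most 1 slightly.\<close>

lemma mem_if_gauge_fun_less_1:
  assumes "gauge_fun B x < 1"
  shows "x \<in> B"
proof -
  obtain t where t: "t > 0" "x /\<^sub>R t \<in> B" "t < 1"
    using le_gauge_fun[of x 1] assms by (meson not_le)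
  have "(1 - t) *\<^sub>R 0 + t *\<^sub>R (x /\<^sub>R t) \<in> B"
    by (rule convexD[OF convex cball_subset t(2)]) (use t in auto)
  with t(1) show ?thesis by simp
qed

lemma gauge_fun_le_norm: "gauge_fun B x \<le> norm x"
proof (rule field_le_epsilon)
  fix e :: real assume "e > 0"
  then show "gauge_fun B x \<le> norm x + e"
    by (intro gauge_fun_le norm_imp_scaled_mem) (auto simp: add_nonneg_pos)
qed

lemma norm_le_gauge_fun: "norm x \<le> R * gauge_fun B x"
proof (cases "R = 0")
  case True
  have "x /\<^sub>R (norm x + 1) \<in> B"
    by (rule norm_imp_scaled_mem) (simp_all add: add_nonneg_pos)
  moreover have "norm x + 1 > 0" by (simp add: add_nonneg_pos)
  ultimately show ?thesis using norm_le[of "x /\<^sub>R (norm x + 1)"] True by (simp add: mult_le_0_iff)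
next
  case False
  then have R: "R > 0" using R_nonneg by simp
  have "norm x / R \<le> gauge_fun B x"
  proof (rule le_gauge_fun)
    fix t :: real assume t: "t > 0" "x /\<^sub>R t \<in> B"
    from norm_le[OF t(2)] t(1) R show "norm x / R \<le> t" by (simp add: field_simps)
  qed
  with R show ?thesis by (simp add: field_simps)
qed

lemma sublinear_gauge_fun: "sublinear (gauge_fun B)"
proof (rule sublinearI)
  show "gauge_fun B (x + y) \<le> gauge_fun B x + gauge_fun B y" for x y
  proof -
    have *: "gauge_fun B (x + y) \<le> s + t"
      if s: "s > 0" "x /\<^sub>R s \<in> B" and t: "t > 0" "y /\<^sub>R t \<in> B" for s t
    proof (rule gauge_fun_le)
      have "(s / (s + t)) *\<^sub>R (x /\<^sub>R s) + (t / (s + t)) *\<^sub>R (y /\<^sub>R t) \<in> B"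
        using s t by (intro convexD[OF convex s(2) t(2)]) (auto simp: add_divide_distrib[symmetric])
      also have "(s / (s + t)) *\<^sub>R (x /\<^sub>R s) + (t / (s + t)) *\<^sub>R (y /\<^sub>R t) = (x + y) /\<^sub>R (s + t)"
      proof -
        have "s / (s + t) * inverse s = inverse (s + t)" "t / (s + t) * inverse t = inverse (s + t)"
          using s(1) t(1) by (simp_all add: field_simps)
        then show ?thesis by (simp only: scaleR_scaleR scaleR_right_distrib)
      qed
      finally show "(x + y) /\<^sub>R (s + t) \<in> B" .
    qed (use s t in simp)
    have "gauge_fun B (x + y) - gauge_fun B x \<le> gauge_fun B y"
    proof (rule le_gauge_fun)
      fix t :: real assume t: "t > 0" "y /\<^sub>R t \<in> B"
      have "gauge_fun B (x + y) - t \<le> gauge_fun B x"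
        by (rule le_gauge_fun) (use *[OF _ _ t] in \<open>simp add: diff_le_eq\<close>)
      then show "gauge_fun B (x + y) - gauge_fun B x \<le> t" by simp
    qed
    then show ?thesis by simp
  qed
  show "gauge_fun B 0 = 0"
  proof (rule antisym)
    show "gauge_fun B 0 \<le> 0" using gauge_fun_le_norm[of 0] by simp
    show "0 \<le> gauge_fun B 0" by (rule le_gauge_fun) simp
  qed
  show "gauge_fun B (r *\<^sub>R x) \<le> r * gauge_fun B x" if r: "r > 0" for r x
  proof -
    have "gauge_fun B (r *\<^sub>R x) / r \<le> gauge_fun B x"
    proof (rule le_gauge_fun)
      fix t :: real assume t: "t > 0" "x /\<^sub>R t \<in> B"
      have "(r *\<^sub>R x) /\<^sub>R (r * t) = x /\<^sub>R t" using r by simp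
      then have "gauge_fun B (r *\<^sub>R x) \<le> r * t"
        using r t by (intro gauge_fun_le) (simp_all only: mult_pos_pos)
      with r show "gauge_fun B (r *\<^sub>R x) / r \<le> t" by (simp add: field_simps)
    qed
    with r show ?thesis by (simp add: field_simps)
  qed
qed

lemma gauge_fun_minus: "gauge_fun B (- x) = gauge_fun B x"
proof -
  have "y \<in> B \<longleftrightarrow> - y \<in> B" for y using symmetric[of y] symmetric[of "- y"] by auto
  then show ?thesis unfolding gauge_fun_def by simp
qed

lemma equivalent_norm_gauge_fun: "equivalent_norm (gauge_fun B)"
  unfolding equivalent_norm_def
proof (intro conjI allI)
  show "gauge_fun B x = 0 \<longleftrightarrow> x = 0" for x
    using norm_le_gauge_fun[of x] sublinear_0[OF sublinear_gauge_fun] by auto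
  show "gauge_fun B (a *\<^sub>R x) = \<bar>a\<bar> * gauge_fun B x" for a x
    using sublinear_scale[OF sublinear_gauge_fun, of "\<bar>a\<bar>" x] gauge_fun_minus[of "a *\<^sub>R x"]
    by (cases "a \<ge> 0") auto
  show "gauge_fun B (x + y) \<le> gauge_fun B x + gauge_fun B y" for x y
    by (rule sublinear_add[OF sublinear_gauge_fun])
  have "(1 / (R + 1)) * norm x \<le> gauge_fun B x" for x
  proof -
    have "0 \<le> gauge_fun B x" by (rule le_gauge_fun) simp
    with norm_le_gauge_fun[of x] R_nonneg show ?thesis by (simp add: field_simps)
  qed
  moreover have "gauge_fun B x \<le> 1 * norm x" for x using gauge_fun_le_norm[of x] by simp
  moreover have "1 / (R + 1) > 0" using R_nonneg by simp
  ultimately show "\<exists>a>0. \<exists>b>0. \<forall>x. a * norm x \<le> gauge_fun B x \<and> gauge_fun B x \<le> b * norm x"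
    using zero_less_one by blast
qed

end

subsection \<open>The renorming\<close>

text \<open>For convex \<open>C\<close> the term
  \<open>\<theta> *\<^sub>R c - (1 - \<theta>) *\<^sub>R c'\<close> runs through the convex hull of
  \<open>C \<union> - C\<close>. Explicit weights make it possible to vary one component while the
  others stay fixed. The set need not be closed, but for convex \<open>C \<noteq> {}\<close> its
  closure has the same gauge.\<close>

definition renorming_body :: "'a::real_normed_vector set \<Rightarrow> 'a set" where
  "renorming_body C = {\<theta> *\<^sub>R c - (1 - \<theta>) *\<^sub>R c' + b |\<theta> c c' b.
     0 \<le> \<theta> \<and> \<theta> \<le> 1 \<and> c \<in> C \<and> c' \<in> C \<and> norm b \<le> 1}"

lemma renorming_bodyI:
  "0 \<le> \<theta> \<Longrightarrow> \<theta> \<le> 1 \<Longrightarrow> c \<in> C \<Longrightarrow> c' \<in> C \<Longrightarrow> norm b \<le> 1 \<Longrightarrow>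
    x = \<theta> *\<^sub>R c - (1 - \<theta>) *\<^sub>R c' + b \<Longrightarrow> x \<in> renorming_body C"
  unfolding renorming_body_def by blast

lemma renorming_bodyE:
  assumes "x \<in> renorming_body C"
  obtains \<theta> c c' b where "0 \<le> \<theta>" "\<theta> \<le> 1" "c \<in> C" "c' \<in> C" "norm b \<le> 1"
    "x = \<theta> *\<^sub>R c - (1 - \<theta>) *\<^sub>R c' + b"
  using assms unfolding renorming_body_def by blast

text \<open>The identity \<open>s C + t C = (s + t) C\<close> for convex sets; if both scalars
  vanish, any point of \<open>C\<close> serves.\<close>

lemma convex_scaled_sum:
  assumes "convex C" "x \<in> C" "y \<in> C" "s \<ge> 0" "t \<ge> 0"
  obtains z where "z \<in> C" "s *\<^sub>R x + t *\<^sub>R y = (s + t) *\<^sub>R z"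
proof (cases "s + t = 0")
  case True
  then have "s = 0" "t = 0" using assms by auto
  with that[of x] assms(2) show thesis by simp
next
  case False
  have "(s / (s + t)) *\<^sub>R x + (t / (s + t)) *\<^sub>R y \<in> C"
    using assms False by (intro convexD[OF assms(1)]) (auto simp: add_divide_distrib[symmetric])
  with that show thesis using False by (simp add: scaleR_right_distrib)
qed

lemma convex_renorming_body:
  assumes C: "convex C"
  shows "convex (renorming_body C)"
proof (rule convexI)
  fix x y and u v :: real
  assume xy: "x \<in> renorming_body C" "y \<in> renorming_body C" and uv: "0 \<le> u" "0 \<le> v" "u + v = 1"
  obtain \<theta> c c' b where x: "0 \<le> \<theta>" "\<theta> \<le> 1" "c \<in> C" "c' \<in> C" "norm b \<le> 1"
    "x = \<theta> *\<^sub>R c - (1 - \<theta>) *\<^sub>R c' + b" using xy(1) by (rule renorming_bodyE)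
  obtain \<mu> d d' e where y: "0 \<le> \<mu>" "\<mu> \<le> 1" "d \<in> C" "d' \<in> C" "norm e \<le> 1"
    "y = \<mu> *\<^sub>R d - (1 - \<mu>) *\<^sub>R d' + e" using xy(2) by (rule renorming_bodyE)
  \<comment> \<open>The components from \<open>C\<close> and those from \<open>- C\<close> are
    merged separately; the two merged weights again add up to 1.\<close>
  obtain z where z: "z \<in> C" "(u * \<theta>) *\<^sub>R c + (v * \<mu>) *\<^sub>R d = (u * \<theta> + v * \<mu>) *\<^sub>R z"
    using convex_scaled_sum[OF C x(3) y(3), of "u * \<theta>" "v * \<mu>"] uv x y by auto
  obtain z' where z': "z' \<in> C" "(u * (1 - \<theta>)) *\<^sub>R c' + (v * (1 - \<mu>)) *\<^sub>R d'
      = (u * (1 - \<theta>) + v * (1 - \<mu>)) *\<^sub>R z'"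
    using convex_scaled_sum[OF C x(4) y(4), of "u * (1 - \<theta>)" "v * (1 - \<mu>)"] uv x y by auto
  have "u * \<theta> + v * \<mu> \<le> u * 1 + v * 1" using x y uv by (intro add_mono mult_left_mono)
  then have le: "u * \<theta> + v * \<mu> \<le> 1" using uv by simp
  have "norm (u *\<^sub>R b + v *\<^sub>R e) \<le> u * norm b + v * norm e"
    using norm_triangle_ineq[of "u *\<^sub>R b" "v *\<^sub>R e"] uv by simp
  also have "\<dots> \<le> u * 1 + v * 1" using x y uv by (intro add_mono mult_left_mono)
  finally have be: "norm (u *\<^sub>R b + v *\<^sub>R e) \<le> 1" using uv by simp
  have compl: "u * (1 - \<theta>) + v * (1 - \<mu>) = 1 - (u * \<theta> + v * \<mu>)"
    using uv by (simp add: algebra_simps)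
  have "u *\<^sub>R x + v *\<^sub>R y = ((u * \<theta>) *\<^sub>R c + (v * \<mu>) *\<^sub>R d)
      - ((u * (1 - \<theta>)) *\<^sub>R c' + (v * (1 - \<mu>)) *\<^sub>R d') + (u *\<^sub>R b + v *\<^sub>R e)"
    by (simp add: x(6) y(6) algebra_simps)
  also have "\<dots> = (u * \<theta> + v * \<mu>) *\<^sub>R z - (1 - (u * \<theta> + v * \<mu>)) *\<^sub>R z' + (u *\<^sub>R b + v *\<^sub>R e)"
    unfolding z(2) z'(2) compl ..
  finally show "u *\<^sub>R x + v *\<^sub>R y \<in> renorming_body C"
    using uv x y z z' le be by (intro renorming_bodyI) auto
qed

locale renorming =
  fixes C :: "'a::banach set" and M :: real
  assumes nonempty: "C \<noteq> {}" and convex_C: "convex C" and bound: "c \<in> C \<Longrightarrow> norm c \<le> M"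
begin

definition N :: "'a \<Rightarrow> real" where "N = gauge_fun (renorming_body C)"

lemma bounded_C: "bounded C"
  using bound by (auto simp: bounded_iff)

text \<open>In the radius, \<open>M\<close> bounds the convex hull of \<open>C \<union> - C\<close>
  and 1 bounds the ball summand.\<close>

sublocale body: symmetric_body "renorming_body C" "M + 1"
proof
  show "convex (renorming_body C)" by (rule convex_renorming_body[OF convex_C])
  fix x
  show "- x \<in> renorming_body C" if x: "x \<in> renorming_body C"
  proof -
    obtain \<theta> c c' b where "0 \<le> \<theta>" "\<theta> \<le> 1" "c \<in> C" "c' \<in> C" "norm b \<le> 1"
      "x = \<theta> *\<^sub>R c - (1 - \<theta>) *\<^sub>R c' + b" using x by (rule renorming_bodyE)
    then show ?thesis by (intro renorming_bodyI[of "1 - \<theta>" c' C c "- b"]) auto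
  qed
  show "x \<in> renorming_body C" if "norm x \<le> 1"
  proof -
    obtain c where "c \<in> C" using nonempty by blast
    \<comment> \<open>Equal components with weight 1/2 cancel and leave the ball summand.\<close>
    with that show ?thesis by (intro renorming_bodyI[of "1/2" c C c x]) auto
  qed
  show "norm x \<le> M + 1" if mem: "x \<in> renorming_body C"
  proof -
    obtain \<theta> c c' b where x: "0 \<le> \<theta>" "\<theta> \<le> 1" "c \<in> C" "c' \<in> C" "norm b \<le> 1"
      "x = \<theta> *\<^sub>R c - (1 - \<theta>) *\<^sub>R c' + b" using mem by (rule renorming_bodyE)
    have "norm x \<le> norm (\<theta> *\<^sub>R c) + norm ((1 - \<theta>) *\<^sub>R c') + norm b"
      unfolding x(6) by (meson norm_triangle_ineq norm_triangle_ineq4 add_right_mono order_trans)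
    also have "\<dots> \<le> \<theta> * M + (1 - \<theta>) * M + 1"
      using x bound[of c] bound[of c'] by (intro add_mono) (auto intro: mult_left_mono)
    finally show ?thesis by (simp add: algebra_simps)
  qed
qed

sublocale equiv_norm N
  by unfold_locales (simp add: N_def body.equivalent_norm_gauge_fun)

lemma N_le_1: "x \<in> renorming_body C \<Longrightarrow> N x \<le> 1"
  unfolding N_def by (rule body.gauge_fun_le_1)

lemma mem_renorming_body: "N x < 1 \<Longrightarrow> x \<in> renorming_body C"
  unfolding N_def by (rule body.mem_if_gauge_fun_less_1)

lemma norm_le_N: "norm x \<le> (M + 1) * N x"
  unfolding N_def by (rule body.norm_le_gauge_fun)

lemma diameter_le_N:
  assumes "0 \<le> d" "\<And>x y. x \<in> S \<Longrightarrow> y \<in> S \<Longrightarrow> N (x - y) \<le> d"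
  shows "diameter S \<le> (M + 1) * d"
proof (rule diameter_le)
  show "S \<noteq> {} \<or> 0 \<le> (M + 1) * d" using assms(1) body.R_nonneg by simp
  fix x y assume "x \<in> S" "y \<in> S"
  then have "(M + 1) * N (x - y) \<le> (M + 1) * d"
    using assms(2) body.R_nonneg by (intro mult_left_mono)
  with norm_le_N[of "x - y"] show "norm (x - y) \<le> (M + 1) * d" by simp
qed

text \<open>On the body, \<open>g\<close> is a convex combination of values \<open>g c\<close> and
  \<open>- g c'\<close> plus a value on the ball; the maximum is the supremum of \<open>g\<close>
  over \<open>C \<union> - C\<close>.\<close>

lemma dual_norm_body_le:
  fixes g :: "'a \<Rightarrow>\<^sub>L real"
  shows "dual_norm g \<le> max (SUP c\<in>C. g c) (SUP c\<in>C. (- g) c) + (SUP b\<in>cball 0 1. g b)"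
    (is "_ \<le> max ?A ?A' + ?\<beta>")
proof (rule dual_norm_le)
  fix x assume x: "N x \<le> 1"
  have body: "g y \<le> max ?A ?A' + ?\<beta>" if y: "y \<in> renorming_body C" for y
  proof -
    obtain \<theta> c c' b where *: "0 \<le> \<theta>" "\<theta> \<le> 1" "c \<in> C" "c' \<in> C" "norm b \<le> 1"
      "y = \<theta> *\<^sub>R c - (1 - \<theta>) *\<^sub>R c' + b" using y by (rule renorming_bodyE)
    have "g c \<le> ?A" "(- g) c' \<le> ?A'"
      using *(3,4) by (auto intro!: cSUP_upper bdd_above_blinfun_image bounded_C)
    then have "g c \<le> max ?A ?A'" "- g c' \<le> max ?A ?A'" by (auto simp: blinfun.minus_left)
    then have "\<theta> * g c + (1 - \<theta>) * (- g c') \<le> max ?A ?A'"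
      using *(1,2) by (intro convex_bound_le) auto
    moreover have "g b \<le> ?\<beta>"
      using *(5) by (intro cSUP_upper bdd_above_blinfun_image) auto
    ultimately show ?thesis
      by (simp add: *(6) blinfun.add_right blinfun.diff_right blinfun.scaleR_right)
  qed
  \<comment> \<open>A vector with \<open>N x = 1\<close> may lie outside the body, so the estimate
    is taken at \<open>r *\<^sub>R x\<close> for all positive \<open>r < 1\<close>.\<close>
  show "g x \<le> max ?A ?A' + ?\<beta>"
  proof (rule field_le_mult_one_interval)
    fix r :: real assume r: "0 < r" "r < 1"
    have "r * N x \<le> r * 1" using x r by (intro mult_left_mono) auto
    also have "\<dots> < 1" using r by simp
    finally have "N (r *\<^sub>R x) < 1" using r by (simp add: scale)
    from body[OF mem_renorming_body[OF this]] show "r * g x \<le> max ?A ?A' + ?\<beta>"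
      by (simp add: blinfun.scaleR_right)
  qed
qed

text \<open>The supremum of \<open>g\<close> over the body is the sum of its suprema over \<open>C \<union> - C\<close> and over the ball,
  so translates of small slices of \<open>C\<close> or \<open>- C\<close> lie in any given slice of the body.\<close>

lemma lip_slice_absorbs_slice:
  assumes S: "S \<in> lip_slices N" and nontriv: "\<exists>x::'a. x \<noteq> 0" and \<kappa>: "\<kappa> > 0"
  shows "\<exists>s T b. (s = 1 \<or> s = -1) \<and> T \<in> slices C \<and> T \<noteq> {} \<and>
    (\<forall>z\<in>T. \<exists>a\<in>S. N (a - (s *\<^sub>R z + b)) \<le> \<kappa>)"
proof -
  obtain g :: "'a \<Rightarrow>\<^sub>L real" and \<alpha> where g: "g \<noteq> 0" "\<alpha> > 0"
    "slice (unit_ball N) g \<alpha> \<inter> unit_sphere N \<subseteq> S"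
    using lip_slices_contain_slice[OF S nontriv] by metis
  define \<beta> where "\<beta> = (SUP b\<in>cball 0 1. g b)"
  \<comment> \<open>The sign records which of \<open>C\<close> and \<open>- C\<close> carries the
    larger supremum; a slice of \<open>- C\<close> is handled as a slice of \<open>C\<close> for
    \<open>- g\<close>.\<close>
  obtain s :: real where s: "s = 1 \<or> s = -1" "dual_norm g \<le> (SUP c\<in>C. (s *\<^sub>R g) c) + \<beta>"
  proof (cases "(SUP c\<in>C. g c) \<ge> (SUP c\<in>C. (- g) c)")
    case True
    with dual_norm_body_le[of g] show thesis by (intro that[of 1]) (auto simp: \<beta>_def)
  next
    case False
    with dual_norm_body_le[of g] show thesis by (intro that[of "-1"]) (auto simp: \<beta>_def)
  qed
  define q where "q = dual_norm g"
  have q: "q > 0" unfolding q_def using g(1) by (rule dual_norm_pos)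
  \<comment> \<open>\<open>\<epsilon> < \<alpha>\<close> keeps the points in the slice,
    \<open>\<epsilon> \<le> \<kappa> * q\<close> brings them within \<open>\<kappa>\<close> of the
    sphere, and \<open>\<epsilon> < q\<close> makes \<open>g\<close> positive on them. Half of
    \<open>\<epsilon>\<close> is spent in \<open>C\<close>, half on the choice of
    \<open>b\<close>.\<close>
  define \<epsilon> where "\<epsilon> = min (\<alpha> / 2) (min (\<kappa> * q) (q / 2))"
  have \<epsilon>: "\<epsilon> > 0" "\<epsilon> < \<alpha>" "\<epsilon> \<le> \<kappa> * q" "\<epsilon> < q" using g(2) \<kappa> q by (auto simp: \<epsilon>_def)
  define T where "T = slice C (s *\<^sub>R g) (\<epsilon> / 2)"
  have "s *\<^sub>R g \<noteq> 0" using g(1) s(1) by auto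
  then have T: "T \<in> slices C" unfolding T_def slices_def using \<epsilon>(1) by (auto intro!: exI)
  have "T \<noteq> {}" unfolding T_def using nonempty \<epsilon>(1) by (intro slice_nonempty) auto
  \<comment> \<open>One \<open>b\<close> serves for all \<open>z\<close>, so it acts as a fixed
    translation.\<close>
  obtain b where b: "norm b \<le> 1" "g b > \<beta> - \<epsilon> / 2"
    using slice_nonempty[of "cball 0 1 :: 'a set" "\<epsilon> / 2" g] \<epsilon>(1) by (auto simp: slice_def \<beta>_def)
  have "\<exists>a\<in>S. N (a - (s *\<^sub>R z + b)) \<le> \<kappa>" if z: "z \<in> T" for z
  proof -
    define y where "y = s *\<^sub>R z + b"
    have zC: "z \<in> C" and gz: "s * g z > (SUP c\<in>C. (s *\<^sub>R g) c) - \<epsilon> / 2"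
      using z by (auto simp: T_def slice_def blinfun.scaleR_left)
    have gy: "g y > q - \<epsilon>"
      using gz b(2) s(2) by (simp add: y_def q_def blinfun.add_right blinfun.scaleR_right)
    have "y \<in> renorming_body C"
      using s(1)
    proof
      assume "s = 1"
      then show ?thesis using zC b(1)
        by (intro renorming_bodyI[of 1 z C z b]) (auto simp: y_def)
    next
      assume "s = -1"
      then show ?thesis using zC b(1)
        by (intro renorming_bodyI[of 0 z C z b]) (auto simp: y_def)
    qed
    then have Ny: "N y \<le> 1" by (rule N_le_1)
    have "y \<noteq> 0" using gy \<epsilon>(4) by (auto simp: blinfun.zero_right)
    then have pos: "N y > 0" by (simp add: pos_iff)
    define a where "a = y /\<^sub>R N y"
    have a: "N a = 1" "N (a - y) = 1 - N y"
      using normalize[OF \<open>y \<noteq> 0\<close> Ny] by (simp_all add: a_def)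
    \<comment> \<open>A value of \<open>g\<close> close to \<open>q\<close> occurs only near the
      sphere: this inequality bounds \<open>1 - N y\<close> by \<open>\<kappa>\<close>.\<close>
    have "g y \<le> q * N y" unfolding q_def by (rule le_dual_norm)
    then have "q - \<kappa> * q < q * N y" using gy \<epsilon>(3) by simp
    then have "q * (1 - N y) < q * \<kappa>" by (simp add: algebra_simps)
    then have close: "N (a - y) \<le> \<kappa>" using q a(2) by simp
    have "g y \<le> g y / N y"
      using pos Ny gy \<epsilon>(4) by (simp add: le_divide_eq mult_left_le)
    then have "g a > q - \<alpha>"
      using gy \<epsilon>(2) by (simp add: a_def blinfun.scaleR_right divide_inverse_commute)
    then have "a \<in> slice (unit_ball N) g \<alpha> \<inter> unit_sphere N"
      using a(1) by (simp add: slice_def unit_ball_def unit_sphere_def q_def dual_norm_def)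
    with g(3) close show ?thesis unfolding y_def by blast
  qed
  with s(1) T \<open>T \<noteq> {}\<close> show ?thesis by blast
qed

text \<open>Reflection and translation preserve \<open>N\<close>-distances, so only the two
  displacements by at most \<open>\<kappa>\<close> are lost.\<close>

lemma slice_from_lip_slice:
  assumes S: "S \<in> lip_slices N" and nontriv: "\<exists>x::'a. x \<noteq> 0" and \<kappa>: "\<kappa> > 0"
  obtains T where "T \<in> slices C"
    "\<And>z w. z \<in> T \<Longrightarrow> w \<in> T \<Longrightarrow> N (z - w) \<le> norm_diameter N S + 2 * \<kappa>"
proof -
  obtain s :: real and T b where T: "s = 1 \<or> s = -1" "T \<in> slices C"
    "\<forall>z\<in>T. \<exists>a\<in>S. N (a - (s *\<^sub>R z + b)) \<le> \<kappa>"
    using lip_slice_absorbs_slice[OF assms] by blast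
  have "N (z - w) \<le> norm_diameter N S + 2 * \<kappa>" if zw: "z \<in> T" "w \<in> T" for z w
  proof -
    obtain x y where x: "x \<in> S" "N (x - (s *\<^sub>R z + b)) \<le> \<kappa>"
      and y: "y \<in> S" "N (y - (s *\<^sub>R w + b)) \<le> \<kappa>" using T(3) zw by blast
    have "N (x - y) \<le> norm_diameter N S"
      using x(1) y(1) lip_slices_subset[OF S] unit_sphere_subset by (intro le_norm_diameter) auto
    moreover have "N ((s *\<^sub>R z + b) - (s *\<^sub>R w + b))
        \<le> N ((s *\<^sub>R z + b) - x) + (N (x - y) + N (y - (s *\<^sub>R w + b)))"
      using triangle_diff[of "s *\<^sub>R z + b" "s *\<^sub>R w + b" x] triangle_diff[of x "s *\<^sub>R w + b" y]
      by simp
    moreover have "N ((s *\<^sub>R z + b) - (s *\<^sub>R w + b)) = N (z - w)"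
      using T(1) scale[of s "z - w"] by (auto simp: scaleR_right_diff_distrib)
    ultimately show ?thesis
      using x(2) y(2) minus_commute[of x "s *\<^sub>R z + b"] by simp
  qed
  with T(2) that show thesis by blast
qed

text \<open>The summands may come with different signs. The sign \<open>\<sigma>\<close> of total
  weight at least 1/2 is kept; points of the other slices are frozen and cancel in differences. What
  remains is \<open>\<sigma> * \<Lambda> \<sigma>\<close> times a difference of points of the new
  combination, whence the factor 2.\<close>

lemma convex_combination_from_lip_slices:
  assumes S: "S \<in> convex_combinations (lip_slices N)" "S \<subseteq> unit_ball N"
    and nontriv: "\<exists>x::'a. x \<noteq> 0" and \<kappa>: "\<kappa> > 0"
  obtains T where "T \<in> convex_combinations (slices C)"
    "\<And>z w. z \<in> T \<Longrightarrow> w \<in> T \<Longrightarrow> N (z - w) \<le> 2 * (norm_diameter N S + 2 * \<kappa>)"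
proof -
  obtain n :: nat and c P where P: "S = {\<Sum>i=1..n. c i *\<^sub>R s i |s. \<forall>i\<in>{1..n}. s i \<in> P i}"
    "n \<ge> 1" "\<forall>i\<in>{1..n}. c i \<ge> 0 \<and> P i \<in> lip_slices N" "(\<Sum>i=1..n. c i) = 1"
    using S(1) by (rule convex_combinationsE)
  have "\<forall>i\<in>{1..n}. \<exists>s T b. (s = 1 \<or> s = -1) \<and> T \<in> slices C \<and> T \<noteq> {} \<and>
      (\<forall>z\<in>T. \<exists>a\<in>P i. N (a - (s *\<^sub>R z + b)) \<le> \<kappa>)"
    using P(3) lip_slice_absorbs_slice[OF _ nontriv \<kappa>] by blast
  then obtain s T b where T: "\<forall>i\<in>{1..n}. (s i = (1::real) \<or> s i = -1) \<and> T i \<in> slices C \<and> T i \<noteq> {} \<and>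
      (\<forall>z\<in>T i. \<exists>a\<in>P i. N (a - (s i *\<^sub>R z + b i)) \<le> \<kappa>)"
    by metis
  then obtain A where A: "\<And>i z. i \<in> {1..n} \<Longrightarrow> z \<in> T i \<Longrightarrow> A i z \<in> P i"
    "\<And>i z. i \<in> {1..n} \<Longrightarrow> z \<in> T i \<Longrightarrow> N (A i z - (s i *\<^sub>R z + b i)) \<le> \<kappa>"
    by metis
  define w where "w i = (SOME z. z \<in> T i)" for i
  have w: "w i \<in> T i" if "i \<in> {1..n}" for i
    using T that unfolding w_def by (simp add: some_in_eq)
  define \<Lambda> where "\<Lambda> \<sigma> = (\<Sum>i\<in>{i\<in>{1..n}. s i = \<sigma>}. c i)" for \<sigma> :: real
  have "\<Lambda> 1 + \<Lambda> (-1) = (\<Sum>i\<in>{i\<in>{1..n}. s i = 1} \<union> {i\<in>{1..n}. s i = -1}. c i)"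
    unfolding \<Lambda>_def by (rule sum.union_disjoint[symmetric]) auto
  also have "{i\<in>{1..n}. s i = 1} \<union> {i\<in>{1..n}. s i = -1} = {1..n}" using T by blast
  finally have "\<Lambda> 1 + \<Lambda> (-1) = 1" using P(4) by simp
  then obtain \<sigma> :: real where \<sigma>: "\<sigma> = 1 \<or> \<sigma> = -1" "\<Lambda> \<sigma> \<ge> 1 / 2"
    by (metis add_mono_thms_linordered_field(5) field_sum_of_halves not_le less_irrefl)
  \<comment> \<open>The kept weights are rescaled to sum 1; a slice of the other sign gets weight 0
    but stays in the family.\<close>
  define d where "d i = (if s i = \<sigma> then c i / \<Lambda> \<sigma> else 0)" for i
  define U where "U = {\<Sum>i=1..n. d i *\<^sub>R z i |z. \<forall>i\<in>{1..n}. z i \<in> T i}"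
  have "(\<Sum>i=1..n. d i) = (\<Sum>i\<in>{i\<in>{1..n}. s i = \<sigma>}. c i / \<Lambda> \<sigma>)"
    unfolding d_def by (rule sum.inter_filter[symmetric]) simp
  also have "\<dots> = 1" using \<sigma>(2) by (simp add: \<Lambda>_def flip: sum_divide_distrib)
  finally have d: "(\<Sum>i=1..n. d i) = 1" .
  have "U \<in> convex_combinations (slices C)"
    unfolding U_def using P(2,3) T \<sigma>(2) d by (intro convex_combinationsI) (auto simp: d_def)
  moreover have "N (x - y) \<le> 2 * (norm_diameter N S + 2 * \<kappa>)" if "x \<in> U" "y \<in> U" for x y
  proof -
    obtain z where z: "x = (\<Sum>i=1..n. d i *\<^sub>R z i)" "\<forall>i\<in>{1..n}. z i \<in> T i"
      using \<open>x \<in> U\<close> unfolding U_def by blast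
    obtain z' where z': "y = (\<Sum>i=1..n. d i *\<^sub>R z' i)" "\<forall>i\<in>{1..n}. z' i \<in> T i"
      using \<open>y \<in> U\<close> unfolding U_def by blast
    define v where "v i = (if s i = \<sigma> then z i else w i)" for i
    define v' where "v' i = (if s i = \<sigma> then z' i else w i)" for i
    have v: "v i \<in> T i" "v' i \<in> T i" if "i \<in> {1..n}" for i
      using that z(2) z'(2) w by (auto simp: v_def v'_def)
    define a where "a = (\<Sum>i=1..n. c i *\<^sub>R A i (v i))"
    define a' where "a' = (\<Sum>i=1..n. c i *\<^sub>R A i (v' i))"
    have mem: "(\<Sum>i=1..n. c i *\<^sub>R A i (u i)) \<in> S" if "\<And>i. i \<in> {1..n} \<Longrightarrow> u i \<in> T i" for u
      unfolding P(1) using A(1) that by (intro CollectI exI[of _ "\<lambda>i. A i (u i)"]) auto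
    have "a \<in> S" unfolding a_def by (rule mem[OF v(1)])
    moreover have "a' \<in> S" unfolding a'_def by (rule mem[OF v(2)])
    ultimately have aa: "N (a - a') \<le> norm_diameter N S" using S(2) by (intro le_norm_diameter)
    have near: "N ((\<Sum>i=1..n. c i *\<^sub>R A i (u i)) - (\<Sum>i=1..n. c i *\<^sub>R (s i *\<^sub>R u i + b i))) \<le> \<kappa>"
      if u: "\<And>i. i \<in> {1..n} \<Longrightarrow> u i \<in> T i" for u
    proof -
      have "N (\<Sum>i=1..n. c i *\<^sub>R (A i (u i) - (s i *\<^sub>R u i + b i)))
          \<le> (\<Sum>i=1..n. N (c i *\<^sub>R (A i (u i) - (s i *\<^sub>R u i + b i))))" by (rule sum_le)
      also have "\<dots> \<le> (\<Sum>i=1..n. c i * \<kappa>)"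
        using P(3) A(2) u by (intro sum_mono) (simp add: scale mult_left_mono)
      also have "\<dots> = \<kappa>" using P(4) by (simp flip: sum_distrib_right)
      finally show ?thesis by (simp only: scaleR_right_diff_distrib sum_subtractf)
    qed
    define t where "t = (\<Sum>i=1..n. c i *\<^sub>R (s i *\<^sub>R v i + b i))"
    define t' where "t' = (\<Sum>i=1..n. c i *\<^sub>R (s i *\<^sub>R v' i + b i))"
    have "t - t' = (\<Sum>i=1..n. c i *\<^sub>R (s i *\<^sub>R v i + b i) - c i *\<^sub>R (s i *\<^sub>R v' i + b i))"
      unfolding t_def t'_def by (rule sum_subtractf[symmetric])
    also have "\<dots> = (\<Sum>i=1..n. (\<sigma> * \<Lambda> \<sigma>) *\<^sub>R (d i *\<^sub>R z i - d i *\<^sub>R z' i))"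
      using \<sigma>(2) by (intro sum.cong refl) (auto simp: v_def v'_def d_def algebra_simps)
    also have "\<dots> = (\<sigma> * \<Lambda> \<sigma>) *\<^sub>R (x - y)"
      unfolding z(1) z'(1) sum_subtractf[symmetric] by (rule scaleR_right.sum[symmetric])
    finally have "N (t - t') = \<Lambda> \<sigma> * N (x - y)"
      using \<sigma> by (auto simp: scale)
    moreover have "N (t - t') \<le> N (t - a) + (N (a - a') + N (a' - t'))"
      using triangle_diff[of t t' a] triangle_diff[of a t' a'] by simp
    moreover have "N (a - t) \<le> \<kappa>" unfolding a_def t_def by (rule near[OF v(1)])
    moreover have "N (a' - t') \<le> \<kappa>" unfolding a'_def t'_def by (rule near[OF v(2)])
    moreover have "(1 / 2) * N (x - y) \<le> \<Lambda> \<sigma> * N (x - y)"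
      using \<sigma>(2) by (intro mult_right_mono) auto
    ultimately show ?thesis using aa minus_commute[of a t] by simp
  qed
  ultimately show thesis by (rule that)
qed

text \<open>A slightly shrunk copy of \<open>x\<close> is a combination of a point of
  \<open>C\<close>, one of \<open>- C\<close> and one of the ball. Only the component from
  \<open>C\<close> or \<open>- C\<close> with weight at least 1/2 is varied; a small weak change of
  it keeps the whole point in the neighbourhood of \<open>x\<close> given by finitely many
  functionals.\<close>

lemma weakly_open_from_lip_open:
  assumes U: "openin (lip_topology N) U" "x \<in> U" "U \<subseteq> unit_sphere N" and \<kappa>: "\<kappa> > 0"
  obtains V where "openin (subtopology weak_topology C) V" "V \<noteq> {}"
    "\<And>z w. z \<in> V \<Longrightarrow> w \<in> V \<Longrightarrow> N (z - w) \<le> 2 * (norm_diameter N U + 2 * \<kappa>)"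
proof -
  obtain F :: "('a \<Rightarrow>\<^sub>L real) set" and \<eta> where F: "finite F" "\<eta> > 0"
    "\<forall>y\<in>unit_ball N. (\<forall>g\<in>F. blinfun_apply g y > blinfun_apply g x - \<eta>) \<longrightarrow> (\<exists>a\<in>U. N (a - y) \<le> \<kappa>)"
    using lip_open_weakly_near[OF U(1,2) \<kappa>] by (rule weakly_nearE)
  have x: "N x = 1" using U(2,3) by (auto simp: unit_sphere_def)
  define D where "D = 1 + (\<Sum>g\<in>F. \<bar>blinfun_apply g x\<bar>)"
  have D: "D > 0" unfolding D_def by (intro add_pos_nonneg sum_nonneg) auto
  have Dg: "blinfun_apply g x \<le> D" if "g \<in> F" for g
    using member_le_sum[of g F "\<lambda>g. \<bar>blinfun_apply g x\<bar>"] F(1) that by (auto simp: D_def)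
  \<comment> \<open>The factor \<open>1 - \<tau>\<close> puts \<open>x\<close> strictly inside the
    unit ball, hence into the body, and costs each functional less than
    \<open>\<eta> / 2\<close>.\<close>
  define \<tau> where "\<tau> = min (1/2) (\<eta> / (4 * D))"
  have \<tau>: "\<tau> > 0" "\<tau> < 1" "\<tau> * D < \<eta> / 2"
    using F(2) D by (auto simp: \<tau>_def min_def field_simps)
  define x' where "x' = (1 - \<tau>) *\<^sub>R x"
  have gx': "blinfun_apply g x' > blinfun_apply g x - \<eta> / 2" if "g \<in> F" for g
  proof -
    have "blinfun_apply g x' = blinfun_apply g x - \<tau> * blinfun_apply g x"
      by (simp add: x'_def blinfun.scaleR_right left_diff_distrib)
    moreover have "\<tau> * blinfun_apply g x \<le> \<tau> * D"
      using Dg[OF that] \<tau>(1) by (intro mult_left_mono) auto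
    ultimately show ?thesis using \<tau>(3) by simp
  qed
  have "x' \<in> renorming_body C"
    by (rule mem_renorming_body) (use x \<tau> in \<open>simp add: x'_def scale\<close>)
  then obtain \<theta> c c' b where *: "0 \<le> \<theta>" "\<theta> \<le> 1" "c \<in> C" "c' \<in> C" "norm b \<le> 1"
    "x' = \<theta> *\<^sub>R c - (1 - \<theta>) *\<^sub>R c' + b" by (rule renorming_bodyE)
  \<comment> \<open>\<open>c0\<close> is the component to be varied, \<open>\<sigma> * \<mu>\<close>
    its signed weight, and \<open>e\<close> collects the other two, which stay fixed.\<close>
  obtain \<sigma> \<mu> :: real and c0 e where \<mu>: "\<sigma> = 1 \<or> \<sigma> = -1" "1 / 2 \<le> \<mu>" "\<mu> \<le> 1" and c0: "c0 \<in> C"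
    and x'_eq: "x' = (\<sigma> * \<mu>) *\<^sub>R c0 + e"
    and body: "\<And>z. z \<in> C \<Longrightarrow> (\<sigma> * \<mu>) *\<^sub>R z + e \<in> renorming_body C"
  proof (cases "\<theta> \<ge> 1 / 2")
    case True
    have "(1 * \<theta>) *\<^sub>R z + (b - (1 - \<theta>) *\<^sub>R c') \<in> renorming_body C" if "z \<in> C" for z
      using * that by (intro renorming_bodyI[of \<theta> z C c' b]) auto
    with * True show thesis
      by (intro that[of 1 \<theta> c "b - (1 - \<theta>) *\<^sub>R c'"]) auto
  next
    case False
    have "(-1 * (1 - \<theta>)) *\<^sub>R z + (b + \<theta> *\<^sub>R c) \<in> renorming_body C" if "z \<in> C" for z
      using * that by (intro renorming_bodyI[of \<theta> c C z b]) (auto simp: algebra_simps)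
    with * False show thesis
      by (intro that[of "-1" "1 - \<theta>" c' "b + \<theta> *\<^sub>R c"]) (auto simp: algebra_simps)
  qed
  \<comment> \<open>The sign moves from the weight to the functionals, since the inequalities are
    one-sided.\<close>
  define G where "G = (\<lambda>g. \<sigma> *\<^sub>R g) ` F"
  define V where "V = {z \<in> C. \<forall>h\<in>G. blinfun_apply h z > blinfun_apply h c0 - \<eta> / 2}"
  have "openin (subtopology weak_topology C) V"
    unfolding V_def by (rule openin_weak_halfspaces) (use F(1) in \<open>simp add: G_def\<close>)
  moreover have "V \<noteq> {}" using c0 F(2) by (auto simp: V_def)
  moreover have "N (z - w) \<le> 2 * (norm_diameter N U + 2 * \<kappa>)" if zw: "z \<in> V" "w \<in> V" for z w
  proof -
    define Y where "Y z = (\<sigma> * \<mu>) *\<^sub>R z + e" for z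
    have near: "\<exists>a\<in>U. N (a - Y z) \<le> \<kappa>" if z: "z \<in> V" for z
    proof -
      have "z \<in> C" using z by (simp add: V_def)
      have "Y z \<in> unit_ball N"
        using N_le_1[OF body[OF \<open>z \<in> C\<close>]] by (simp add: unit_ball_def Y_def)
      moreover have "blinfun_apply g (Y z) > blinfun_apply g x - \<eta>" if g: "g \<in> F" for g
      proof -
        have "\<sigma> * blinfun_apply g z > \<sigma> * blinfun_apply g c0 - \<eta> / 2"
          using z g by (auto simp: V_def G_def blinfun.scaleR_left)
        then have "\<mu> * (\<sigma> * blinfun_apply g c0 - \<sigma> * blinfun_apply g z) \<le> \<mu> * (\<eta> / 2)"
          using \<mu> by (intro mult_left_mono) auto
        also have "\<dots> \<le> \<eta> / 2" using \<mu> F(2) by (simp add: mult_left_le_one_le)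
        finally have "blinfun_apply g x' - blinfun_apply g (Y z) \<le> \<eta> / 2"
          by (simp add: x'_eq Y_def blinfun.add_right blinfun.scaleR_right algebra_simps)
        with gx'[OF g] show ?thesis by simp
      qed
      ultimately show ?thesis using F(3) by blast
    qed
    obtain p q where p: "p \<in> U" "N (p - Y z) \<le> \<kappa>" and q: "q \<in> U" "N (q - Y w) \<le> \<kappa>"
      using near zw by blast
    have "N (p - q) \<le> norm_diameter N U"
      using p(1) q(1) U(3) unit_sphere_subset by (intro le_norm_diameter) auto
    moreover have "N (Y z - Y w) \<le> N (Y z - p) + (N (p - q) + N (q - Y w))"
      using triangle_diff[of "Y z" "Y w" p] triangle_diff[of p "Y w" q] by simp
    moreover have "Y z - Y w = (\<sigma> * \<mu>) *\<^sub>R (z - w)" by (simp add: Y_def scaleR_right_diff_distrib)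
    then have "N (Y z - Y w) = \<mu> * N (z - w)" using \<mu> by (auto simp: scale)
    moreover have "(1 / 2) * N (z - w) \<le> \<mu> * N (z - w)"
      using \<mu>(2) by (intro mult_right_mono) auto
    ultimately show ?thesis using p(2) q(2) minus_commute[of p "Y z"] by simp
  qed
  ultimately show thesis by (rule that)
qed

end

section \<open>The three equivalences\<close>

lemma obtain_renorming:
  fixes C :: "'a::banach set"
  assumes "C \<noteq> {}" "bounded C" "convex C"
  obtains M where "renorming C M"
  using assms by (auto simp: renorming_def bounded_iff)

text \<open>One constant for all three converse implications: \<open>\<epsilon>\<close> bounds the
  diameter of the small set, \<open>2 * \<epsilon>\<close> is the displacement at both ends, the
  factor 2 allows for the weight 1/2, and \<open>R\<close> comes from returning to the original
  norm.\<close>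

lemma small_multiple:
  fixes R \<delta> :: real
  assumes "\<delta> > 0" "R \<ge> 0"
  shows "\<exists>\<epsilon>>0. R * (2 * (\<epsilon> + 2 * \<epsilon>)) < \<delta>"
proof (intro exI conjI)
  define \<epsilon> where "\<epsilon> = \<delta> / (6 * (R + 1))"
  show "\<epsilon> > 0" using assms by (simp add: \<epsilon>_def)
  have "6 * (R + 1) * \<epsilon> = \<delta>" using assms by (simp add: \<epsilon>_def)
  then show "R * (2 * (\<epsilon> + 2 * \<epsilon>)) < \<delta>" using \<open>\<epsilon> > 0\<close> by (simp add: algebra_simps)
qed

theorem theorem2p12:
  assumes "\<exists>x::'a::banach. x \<noteq> 0"
  shows "(RNP TYPE('a) \<longleftrightarrow>
            (\<forall>N :: 'a \<Rightarrow> real. equivalent_norm N \<longrightarrow>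
               (\<forall>\<delta>>0. \<exists>S\<in>lip_slices N. S \<subseteq> unit_sphere N \<and> norm_diameter N S < \<delta>))) \<and>
         (CPCP TYPE('a) \<longleftrightarrow>
            (\<forall>N :: 'a \<Rightarrow> real. equivalent_norm N \<longrightarrow>
               (\<forall>\<delta>>0. \<exists>U. openin (lip_topology N) U \<and> U \<noteq> {} \<and>
                  U \<subseteq> unit_sphere N \<and> norm_diameter N U < \<delta>))) \<and>
         (strongly_regular TYPE('a) \<longleftrightarrow>
            (\<forall>N :: 'a \<Rightarrow> real. equivalent_norm N \<longrightarrow>
               (\<forall>\<delta>>0. \<exists>S\<in>convex_combinations (lip_slices N).
                  S \<subseteq> unit_ball N \<and> norm_diameter N S < \<delta>)))"
proof (intro conjI iffI)
  assume "RNP TYPE('a)"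
  then show "\<forall>N :: 'a \<Rightarrow> real. equivalent_norm N \<longrightarrow>
      (\<forall>\<delta>>0. \<exists>S\<in>lip_slices N. S \<subseteq> unit_sphere N \<and> norm_diameter N S < \<delta>)"
    using equiv_norm.small_lip_slice_if_RNP by (auto simp: equiv_norm_def)
next
  assume "CPCP TYPE('a)"
  then show "\<forall>N :: 'a \<Rightarrow> real. equivalent_norm N \<longrightarrow>
      (\<forall>\<delta>>0. \<exists>U. openin (lip_topology N) U \<and> U \<noteq> {} \<and>
        U \<subseteq> unit_sphere N \<and> norm_diameter N U < \<delta>)"
    using equiv_norm.small_lip_open_if_CPCP[OF _ _ _ assms] by (auto simp: equiv_norm_def)
next
  assume "strongly_regular TYPE('a)"
  then show "\<forall>N :: 'a \<Rightarrow> real. equivalent_norm N \<longrightarrow>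
      (\<forall>\<delta>>0. \<exists>S\<in>convex_combinations (lip_slices N). S \<subseteq> unit_ball N \<and> norm_diameter N S < \<delta>)"
    using equiv_norm.small_convex_combination_if_strongly_regular by (auto simp: equiv_norm_def)
next
  assume small: "\<forall>N :: 'a \<Rightarrow> real. equivalent_norm N \<longrightarrow>
      (\<forall>\<delta>>0. \<exists>S\<in>lip_slices N. S \<subseteq> unit_sphere N \<and> norm_diameter N S < \<delta>)"
  show "RNP TYPE('a)"
    unfolding RNP_def
  proof (intro allI impI)
    fix C :: "'a set" and \<delta> :: real
    assume C: "C \<noteq> {} \<and> closed C \<and> bounded C \<and> convex C" and "\<delta> > 0"
    obtain M where "renorming C M" using obtain_renorming C by metis
    then interpret renorming C M .
    obtain \<epsilon> where \<epsilon>: "\<epsilon> > 0" "(M + 1) * (2 * (\<epsilon> + 2 * \<epsilon>)) < \<delta>"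
      using small_multiple[OF \<open>\<delta> > 0\<close> body.R_nonneg] by blast
    obtain S where S: "S \<in> lip_slices N" "norm_diameter N S < \<epsilon>"
      using small equivalent \<epsilon>(1) by blast
    obtain T where T: "T \<in> slices C"
      "\<And>z w. z \<in> T \<Longrightarrow> w \<in> T \<Longrightarrow> N (z - w) \<le> norm_diameter N S + 2 * \<epsilon>"
      using slice_from_lip_slice[OF S(1) assms \<epsilon>(1)] by metis
    have "diameter T \<le> (M + 1) * (2 * (\<epsilon> + 2 * \<epsilon>))"
    proof (rule diameter_le_N)
      fix z w assume "z \<in> T" "w \<in> T"
      then show "N (z - w) \<le> 2 * (\<epsilon> + 2 * \<epsilon>)" using T(2)[of z w] S(2) \<epsilon>(1) by simp
    qed (use \<epsilon>(1) in simp)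
    with T(1) \<epsilon>(2) show "\<exists>S\<in>slices C. diameter S < \<delta>" by force
  qed
next
  assume small: "\<forall>N :: 'a \<Rightarrow> real. equivalent_norm N \<longrightarrow>
      (\<forall>\<delta>>0. \<exists>U. openin (lip_topology N) U \<and> U \<noteq> {} \<and>
        U \<subseteq> unit_sphere N \<and> norm_diameter N U < \<delta>)"
  show "CPCP TYPE('a)"
    unfolding CPCP_def
  proof (intro allI impI)
    fix C :: "'a set" and \<delta> :: real
    assume C: "C \<noteq> {} \<and> closed C \<and> bounded C \<and> convex C" and "\<delta> > 0"
    obtain M where "renorming C M" using obtain_renorming C by metis
    then interpret renorming C M .
    obtain \<epsilon> where \<epsilon>: "\<epsilon> > 0" "(M + 1) * (2 * (\<epsilon> + 2 * \<epsilon>)) < \<delta>"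
      using small_multiple[OF \<open>\<delta> > 0\<close> body.R_nonneg] by blast
    obtain U where U: "openin (lip_topology N) U" "U \<noteq> {}" "U \<subseteq> unit_sphere N"
      "norm_diameter N U < \<epsilon>"
      using small equivalent \<epsilon>(1) by meson
    obtain x where "x \<in> U" using U(2) by blast
    obtain V where V: "openin (subtopology weak_topology C) V" "V \<noteq> {}"
      "\<And>z w. z \<in> V \<Longrightarrow> w \<in> V \<Longrightarrow> N (z - w) \<le> 2 * (norm_diameter N U + 2 * \<epsilon>)"
      using weakly_open_from_lip_open[OF U(1) \<open>x \<in> U\<close> U(3) \<epsilon>(1)] by metis
    have "diameter V \<le> (M + 1) * (2 * (\<epsilon> + 2 * \<epsilon>))"
    proof (rule diameter_le_N)
      fix z w assume "z \<in> V" "w \<in> V"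
      then show "N (z - w) \<le> 2 * (\<epsilon> + 2 * \<epsilon>)" using V(3)[of z w] U(4) by simp
    qed (use \<epsilon>(1) in simp)
    then have "diameter V < \<delta>" using \<epsilon>(2) by simp
    with V(1,2) show "\<exists>U. openin (subtopology weak_topology C) U \<and> U \<noteq> {} \<and> diameter U < \<delta>"
      by blast
  qed
next
  assume small: "\<forall>N :: 'a \<Rightarrow> real. equivalent_norm N \<longrightarrow>
      (\<forall>\<delta>>0. \<exists>S\<in>convex_combinations (lip_slices N). S \<subseteq> unit_ball N \<and> norm_diameter N S < \<delta>)"
  show "strongly_regular TYPE('a)"
    unfolding strongly_regular_def
  proof (intro allI impI)
    fix C :: "'a set" and \<delta> :: real
    assume C: "C \<noteq> {} \<and> closed C \<and> bounded C \<and> convex C" and "\<delta> > 0"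
    obtain M where "renorming C M" using obtain_renorming C by metis
    then interpret renorming C M .
    obtain \<epsilon> where \<epsilon>: "\<epsilon> > 0" "(M + 1) * (2 * (\<epsilon> + 2 * \<epsilon>)) < \<delta>"
      using small_multiple[OF \<open>\<delta> > 0\<close> body.R_nonneg] by blast
    obtain S where S: "S \<in> convex_combinations (lip_slices N)" "S \<subseteq> unit_ball N"
      "norm_diameter N S < \<epsilon>"
      using small equivalent \<epsilon>(1) by meson
    obtain T where T: "T \<in> convex_combinations (slices C)"
      "\<And>z w. z \<in> T \<Longrightarrow> w \<in> T \<Longrightarrow> N (z - w) \<le> 2 * (norm_diameter N S + 2 * \<epsilon>)"
      using convex_combination_from_lip_slices[OF S(1,2) assms \<epsilon>(1)] by metis
    have "diameter T \<le> (M + 1) * (2 * (\<epsilon> + 2 * \<epsilon>))"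
    proof (rule diameter_le_N)
      fix z w assume "z \<in> T" "w \<in> T"
      then show "N (z - w) \<le> 2 * (\<epsilon> + 2 * \<epsilon>)" using T(2)[of z w] S(3) by simp
    qed (use \<epsilon>(1) in simp)
    with T(1) \<epsilon>(2) show "\<exists>S\<in>convex_combinations (slices C). diameter S < \<delta>" by force
  qed
qed

end
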